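(* Let $[a,b]\subset[0,\infty)$ be a finite closed interval and let $\varphi=(\varphi_1,\varphi_2)$ be a pair of real-valued Lipschitz functions on $[a,b]$ such that $\varphi_1$ and $\varphi_2$ are increasing and $\varphi_1+\varphi_2$ is strictly increasing. Let $T\in \mathbb{M}_n[a,b]$. Then there exists a unique global solution $X:[0,\infty)\to \mathbb{M}_n[a,b]$ of the initial value problem $$\frac{dX(t)}{dt}=[\varphi(X(t)),X(t)],\qquad X(0)=T.$$
   Context: $\mathbb{M}_n$ is the algebra of $n\times n$ complex matrices, $|X|=(X^*X)^{1/2}$, $\sigma(\cdot)$ is the spectrum, and $[A,B]=AB-BA$. $\mathbb{M}_n[a,b]=\{X\in\mathbb{M}_n: \sigma(|X|)\subset[a,b]\}$ (then also $\sigma(|X^*|)\subset[a,b]$). For $X\in\mathbb{M}_n[a,b]$, $\varphi(X):=\varphi_1(|X|)-\varphi_2(|X^*|)$ (functional calculus). "Increasing" means non-decreasing. A solution is understood to take values in $\mathbb{M}_n[a,b]$, where $\varphi$ is defined. *)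

theory Defs
  imports "HOL-Analysis.Analysis"
begin

type_synonym 'n cmat = "complex ^ 'n ^ 'n"

definition mat_adj :: "('n::finite) cmat \<Rightarrow> 'n cmat" where
  "mat_adj X = (\<chi> i j. cnj (X $ j $ i))"

definition mat_spectrum :: "('n::finite) cmat \<Rightarrow> complex set" where
  "mat_spectrum A = {z. \<not> invertible (A - mat z)}"

definition commutator :: "('n::finite) cmat \<Rightarrow> 'n cmat \<Rightarrow> 'n cmat" where
  "commutator A B = A ** B - B ** A"

definition unitary_mat :: "('n::finite) cmat \<Rightarrow> bool" where
  "unitary_mat U \<longleftrightarrow> mat_adj U ** U = mat 1 \<and> U ** mat_adj U = mat 1"

definition real_diag :: "('n::finite \<Rightarrow> real) \<Rightarrow> 'n cmat" where
  "real_diag d = (\<chi> i j. if i = j then of_real (d i) else 0)"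

text \<open>
  Functional calculus for Hermitian matrices:
  if \<open>A = U diag(d) U*\<close> with \<open>U\<close> unitary and \<open>d\<close> real, then \<open>f(A) = U diag(f \<circ> d) U*\<close>.
  The result does not depend on the chosen diagonalization (\<open>herm_fun_eq\<close> below), and
  only the values of \<open>f\<close> on the spectrum of \<open>A\<close> matter.  For non-Hermitian \<open>A\<close> the value is
  unspecified.
\<close>

definition herm_fun :: "(real \<Rightarrow> real) \<Rightarrow> ('n::finite) cmat \<Rightarrow> 'n cmat" where
  "herm_fun f A = (THE B. \<exists>U d. unitary_mat U \<and>
      A = U ** real_diag d ** mat_adj U \<and> B = U ** real_diag (f \<circ> d) ** mat_adj U)"

lemma real_diag_mult_left: "(real_diag d ** A) $ i $ j = of_real (d i) * A $ i $ j"
proof -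
  have "(\<Sum>k\<in>UNIV. (if i = k then complex_of_real (d i) else 0) * A $ k $ j)
      = (\<Sum>k\<in>UNIV. if i = k then of_real (d i) * A $ k $ j else 0)"
    by (intro sum.cong) auto
  then show ?thesis
    by (simp add: matrix_matrix_mult_def real_diag_def)
qed

lemma real_diag_mult_right: "(A ** real_diag d) $ i $ j = A $ i $ j * of_real (d j)"
proof -
  have "(\<Sum>k\<in>UNIV. A $ i $ k * (if k = j then complex_of_real (d k) else 0))
      = (\<Sum>k\<in>UNIV. if k = j then A $ i $ k * of_real (d k) else 0)"
    by (intro sum.cong) auto
  then show ?thesis
    by (simp add: matrix_matrix_mult_def real_diag_def)
qed

lemma diagonalization_unique:
  assumes U: "unitary_mat U" and V: "unitary_mat V"
    and eq: "U ** real_diag d ** mat_adj U = V ** real_diag e ** mat_adj V"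
  shows "U ** real_diag (f \<circ> d) ** mat_adj U = V ** real_diag (f \<circ> e) ** mat_adj V"
proof -
  let ?U = "mat_adj U" and ?V = "mat_adj V"
  define W where "W = ?V ** U"
  have U: "?U ** U = mat 1" "U ** ?U = mat 1" and V: "?V ** V = mat 1" "V ** ?V = mat 1"
    using U V by (auto simp: unitary_mat_def)
  have "W ** real_diag d = ?V ** (U ** real_diag d ** ?U) ** U"
    using U by (simp add: W_def flip: matrix_mul_assoc)
  also have "\<dots> = ?V ** (V ** real_diag e ** ?V) ** U"
    by (simp only: eq)
  also have "\<dots> = real_diag e ** W"
    using V by (simp add: W_def matrix_mul_assoc)
  finally have *: "W $ i $ j * of_real (d j) = of_real (e i) * W $ i $ j" for i j
    by (metis real_diag_mult_left real_diag_mult_right)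
  have "W $ i $ j * of_real (f (d j)) = of_real (f (e i)) * W $ i $ j" for i j
    using *[of i j] by (cases "W $ i $ j = 0") auto
  then have W: "W ** real_diag (f \<circ> d) = real_diag (f \<circ> e) ** W"
    by (simp add: vec_eq_iff real_diag_mult_left real_diag_mult_right)
  have "U ** real_diag (f \<circ> d) ** ?U = V ** (W ** real_diag (f \<circ> d)) ** ?U"
    using V by (simp add: W_def matrix_mul_assoc)
  also have "\<dots> = V ** (real_diag (f \<circ> e) ** W) ** ?U"
    by (simp only: W)
  also have "\<dots> = V ** real_diag (f \<circ> e) ** ?V"
    using U by (simp add: W_def flip: matrix_mul_assoc)
  finally show ?thesis .
qed

lemma herm_fun_eq:
  assumes "unitary_mat U" "A = U ** real_diag d ** mat_adj U"
  shows "herm_fun f A = U ** real_diag (f \<circ> d) ** mat_adj U"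
  unfolding herm_fun_def
proof (rule the_equality)
  show "\<exists>V e. unitary_mat V \<and> A = V ** real_diag e ** mat_adj V \<and>
      U ** real_diag (f \<circ> d) ** mat_adj U = V ** real_diag (f \<circ> e) ** mat_adj V"
    using assms by (intro exI[of _ U] exI[of _ d]) simp
next
  fix B
  assume "\<exists>V e. unitary_mat V \<and> A = V ** real_diag e ** mat_adj V \<and>
      B = V ** real_diag (f \<circ> e) ** mat_adj V"
  then obtain V e where V: "unitary_mat V" "A = V ** real_diag e ** mat_adj V"
    and B: "B = V ** real_diag (f \<circ> e) ** mat_adj V"
    by auto
  show "B = U ** real_diag (f \<circ> d) ** mat_adj U"
    unfolding B by (rule diagonalization_unique) (use V assms in auto)
qed

definition mat_abs :: "('n::finite) cmat \<Rightarrow> 'n cmat" where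
  "mat_abs X = herm_fun sqrt (mat_adj X ** X)"

definition mat_interval :: "real \<Rightarrow> real \<Rightarrow> ('n::finite) cmat set" where
  "mat_interval a b = {X. mat_spectrum (mat_abs X) \<subseteq> of_real ` {a..b}}"

definition phi_mat :: "(real \<Rightarrow> real) \<Rightarrow> (real \<Rightarrow> real) \<Rightarrow> ('n::finite) cmat \<Rightarrow> 'n cmat" where
  "phi_mat \<phi>1 \<phi>2 X = herm_fun \<phi>1 (mat_abs X) - herm_fun \<phi>2 (mat_abs (mat_adj X))"

end

theory Submission
  imports Defs
begin

text \<open>
  Two facts make the initial value problem well posed: the field \<open>X \<mapsto> [\<phi>(X), X]\<close> is Lipschitz on
  bounded sets, and its flow neither raises the largest singular value of \<open>X\<close> nor lowers the
  smallest, so they cannot leave \<open>[a, b]\<close>.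

  For the first, all norms are Hilbert--Schmidt norms.  There the functional calculus of Hermitian
  matrices is as Lipschitz as the scalar function (\<open>herm_fun_lipschitz\<close>), and the absolute value is
  Lipschitz with constant \<open>\<surd>2\<close>, even across singular matrices (\<open>mat_abs_lipschitz\<close>).  Both follow
  from explicit sums over spectral data, for which Hermitian matrices are diagonalized by maximizing
  quadratic forms (\<open>hermitian_diagonalization\<close>).

  For the second, let \<open>v\<close> be a unit vector on which \<open>X\<close> attains its largest singular value \<open>s\<close>.
  Then \<open>\<phi>\<^sub>1(|X|) v = \<phi>\<^sub>1(s) v\<close> and \<open>\<phi>\<^sub>2(|X*|) X v = \<phi>\<^sub>2(s) X v\<close>, while \<open>\<phi>\<^sub>1(|X|) \<le> \<phi>\<^sub>1(s)\<close> and
  \<open>\<phi>\<^sub>2(|X*|) \<le> \<phi>\<^sub>2(s)\<close> as the functions are increasing; together these show that the squared length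
  of \<open>X v\<close> does not grow (\<open>singular_vector_derivative_nonpos\<close>).  At a smallest singular value the
  inequalities are reversed.  Since membership in \<open>mat_interval a b\<close> means that \<open>X\<close> stretches unit
  vectors by factors in \<open>[a, b]\<close> (\<open>mat_interval_iff_unit\<close>), a maximum principle over the unit sphere
  (\<open>maximum_principle\<close>) turns this into invariance (\<open>singular_value_interval_invariant\<close>).

  For existence, the functions \<open>\<phi>\<^sub>1\<close>, \<open>\<phi>\<^sub>2\<close> are extended to increasing Lipschitz functions on the
  line, and the field is composed with the projection onto a ball that contains \<open>mat_interval a b\<close>.
  The result is globally Lipschitz and has a global solution (\<open>lipschitz_ode_global_solution\<close>).  The
  projection only rescales its argument, so the invariance argument still applies; hence the solution
  stays where nothing was changed.  Uniqueness is Gronwall's inequality (\<open>lipschitz_ode_unique\<close>).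
\<close>

section \<open>Adjoints and inner products\<close>

definition cdot :: "complex ^ ('n::finite) \<Rightarrow> complex ^ 'n \<Rightarrow> complex" where
  "cdot u v = (\<Sum>k\<in>UNIV. cnj (u $ k) * v $ k)"

lemma inner_eq_Re_cdot: "u \<bullet> v = Re (cdot u v)"
  by (simp add: cdot_def inner_vec_def inner_complex_def)

lemma cdot_add_right: "cdot u (v + w) = cdot u v + cdot u w"
  and cdot_scaleR_right: "cdot u (r *\<^sub>R v) = of_real r * cdot u v"
  and cdot_scaleR_left: "cdot (r *\<^sub>R u) v = of_real r * cdot u v"
  and cdot_zero_right: "cdot u 0 = 0"
  by (simp_all add: cdot_def sum.distrib algebra_simps sum_distrib_left scaleR_conv_of_real[where 'a=complex])

lemma cdot_commute: "cdot u v = cnj (cdot v u)"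
  by (simp add: cdot_def mult.commute)

lemma cdot_self: "cdot u u = of_real ((norm u)\<^sup>2)"
proof -
  have "Im (cdot u u) = 0" by (simp add: cdot_def mult.commute)
  moreover have "Re (cdot u u) = (norm u)\<^sup>2"
    by (simp add: inner_eq_Re_cdot[symmetric] power2_norm_eq_inner)
  ultimately show ?thesis by (simp add: complex_eq_iff)
qed

text \<open>
  The library's inner product on complex vectors is the real one, the real part of \<open>cdot\<close>.
  Real orthogonality to \<open>u\<close> and to \<open>\<i> u\<close> together is therefore complex orthogonality to \<open>u\<close>.
\<close>

lemma Re_cdot_ii: "Re (cdot (\<i> *s u) v) = Im (cdot u v)"
  by (simp add: cdot_def vector_scalar_mult_def algebra_simps)

lemma cdot_adj: "cdot (A *v u) v = cdot u (mat_adj A *v v)"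
proof -
  have "cdot (A *v u) v = (\<Sum>k\<in>UNIV. \<Sum>j\<in>UNIV. cnj (A $ k $ j) * cnj (u $ j) * v $ k)"
    by (simp add: cdot_def matrix_vector_mult_def sum_distrib_right)
  also have "\<dots> = (\<Sum>j\<in>UNIV. \<Sum>k\<in>UNIV. cnj (A $ k $ j) * cnj (u $ j) * v $ k)"
    by (rule sum.swap)
  also have "\<dots> = cdot u (mat_adj A *v v)"
    by (simp add: cdot_def matrix_vector_mult_def mat_adj_def sum_distrib_left mult_ac)
  finally show ?thesis .
qed

lemma mat_adj_adj [simp]: "mat_adj (mat_adj A) = A"
  by (simp add: mat_adj_def vec_eq_iff)

lemma mat_adj_mult: "mat_adj (A ** B) = mat_adj B ** mat_adj A"
  by (simp add: mat_adj_def vec_eq_iff matrix_matrix_mult_def mult.commute)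

lemma mat_adj_real_diag [simp]: "mat_adj (real_diag d) = real_diag d"
  by (simp add: mat_adj_def real_diag_def vec_eq_iff)

lemma mat_adj_diff: "mat_adj (A - B) = mat_adj A - mat_adj B"
  by (simp add: mat_adj_def vec_eq_iff)

lemma norm_mat_adj [simp]: "norm (mat_adj A) = norm A"
proof -
  have "(norm (mat_adj A))\<^sup>2 = (norm A)\<^sup>2"
    unfolding power2_norm_eq_inner
    by (simp add: inner_vec_def mat_adj_def inner_complex_def) (rule sum.swap)
  then show ?thesis by simp
qed

lemma inner_adj: "(A *v u) \<bullet> v = u \<bullet> (mat_adj A *v v)"
  by (simp add: inner_eq_Re_cdot cdot_adj)

lemma inner_adj': "u \<bullet> (A *v v) = (mat_adj A *v u) \<bullet> v"
  by (simp add: inner_adj)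

lemma norm_mult_sq: "(norm (A *v v))\<^sup>2 = v \<bullet> (mat_adj A ** A *v v)"
  by (simp only: power2_norm_eq_inner inner_adj matrix_vector_mul_assoc)

lemma unitary_norm:
  assumes "unitary_mat U" shows "norm (U *v v) = norm v"
proof -
  have "(norm (U *v v))\<^sup>2 = (norm v)\<^sup>2"
    using assms by (simp add: norm_mult_sq unitary_mat_def) (simp add: power2_norm_eq_inner)
  then show ?thesis by simp
qed

lemma unitary_mat_adj: "unitary_mat U \<Longrightarrow> unitary_mat (mat_adj U)"
  by (simp add: unitary_mat_def)

lemma bilinear_cmat_mult:
  "bilinear ((**) :: ('n::finite) cmat \<Rightarrow> 'n cmat \<Rightarrow> 'n cmat)"
  unfolding bilinear_def linear_iff
  by (simp add: matrix_matrix_mult_def vec_eq_iff sum.distrib algebra_simps scaleR_sum_right)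

lemma bounded_bilinear_cmat_mult:
  "bounded_bilinear ((**) :: ('n::finite) cmat \<Rightarrow> 'n cmat \<Rightarrow> 'n cmat)"
  using bilinear_cmat_mult bilinear_conv_bounded_bilinear by blast

lemma bounded_bilinear_cmat_vec:
  "bounded_bilinear ((*v) :: ('n::finite) cmat \<Rightarrow> complex ^ 'n \<Rightarrow> complex ^ 'n)"
proof -
  have "bilinear ((*v) :: ('n::finite) cmat \<Rightarrow> complex ^ 'n \<Rightarrow> complex ^ 'n)"
    unfolding bilinear_def linear_iff
    by (simp add: matrix_vector_mult_def vec_eq_iff sum.distrib algebra_simps scaleR_sum_right)
  then show ?thesis using bilinear_conv_bounded_bilinear by blast
qed

interpretation cmat_mult: bounded_bilinear "(**) :: ('n::finite) cmat \<Rightarrow> 'n cmat \<Rightarrow> 'n cmat"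
  by (rule bounded_bilinear_cmat_mult)

interpretation cmat_vec: bounded_bilinear "(*v) :: ('n::finite) cmat \<Rightarrow> complex ^ 'n \<Rightarrow> complex ^ 'n"
  by (rule bounded_bilinear_cmat_vec)

lemma inner_eq_trace: "A \<bullet> B = Re (trace (mat_adj A ** B))"
proof -
  have "A \<bullet> B = (\<Sum>i\<in>UNIV. \<Sum>j\<in>UNIV. Re (cnj (A $ i $ j) * B $ i $ j))"
    by (simp add: inner_vec_def inner_complex_def)
  also have "\<dots> = (\<Sum>j\<in>UNIV. \<Sum>i\<in>UNIV. Re (cnj (A $ i $ j) * B $ i $ j))"
    by (rule sum.swap)
  also have "\<dots> = Re (trace (mat_adj A ** B))"
    by (simp add: trace_def matrix_matrix_mult_def mat_adj_def)
  finally show ?thesis .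
qed

text \<open>
  The norm of a matrix is its Hilbert--Schmidt norm.  In that inner product, two matrices given by
  factorizations of singular value type are compared entrywise, through the overlaps of their left
  and of their right factors.
\<close>

lemma inner_sandwich:
  "(A ** real_diag s ** mat_adj B) \<bullet> (C ** real_diag t ** mat_adj D) =
   (\<Sum>i\<in>UNIV. \<Sum>j\<in>UNIV. s i * t j *
      Re ((mat_adj A ** C) $ i $ j * cnj ((mat_adj B ** D) $ i $ j)))"
proof -
  have "mat_adj (A ** real_diag s ** mat_adj B) ** (C ** real_diag t ** mat_adj D)
      = B ** (real_diag s ** (mat_adj A ** C) ** (real_diag t ** mat_adj D))"
    by (simp add: mat_adj_mult matrix_mul_assoc)
  then have "trace (mat_adj (A ** real_diag s ** mat_adj B) ** (C ** real_diag t ** mat_adj D))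
      = trace (real_diag s ** (mat_adj A ** C) ** (real_diag t ** mat_adj D) ** B)"
    by (metis trace_mul_sym)
  also have "\<dots> = trace ((real_diag s ** (mat_adj A ** C)) ** (real_diag t ** mat_adj (mat_adj B ** D)))"
    by (simp add: mat_adj_mult matrix_mul_assoc)
  finally show ?thesis
    unfolding inner_eq_trace trace_def matrix_matrix_mult_def[of "real_diag s ** (mat_adj A ** C)"]
    by (simp add: real_diag_mult_left mat_adj_def algebra_simps sum_distrib_left)
qed

section \<open>Diagonalization of Hermitian matrices\<close>

text \<open>
  The form \<open>v \<bullet> A v - c (v \<bullet> v)\<close> has its maximum \<open>0\<close> at \<open>w\<close>, so it cannot increase to first order
  when \<open>w\<close> moves in the direction of the residual \<open>z = A w - c w\<close>; but that first-order change is
  \<open>2 (z \<bullet> z)\<close>, so the residual vanishes.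
\<close>

lemma maximizer_eigenvector:
  fixes A :: "('n::finite) cmat"
  assumes herm: "mat_adj A = A"
    and V: "subspace V" "\<And>v. v \<in> V \<Longrightarrow> A *v v \<in> V"
    and max: "\<And>v. v \<in> V \<Longrightarrow> v \<bullet> (A *v v) \<le> c * (v \<bullet> v)"
    and w: "w \<in> V" "w \<bullet> (A *v w) = c * (w \<bullet> w)"
  shows "A *v w = c *\<^sub>R w"
proof -
  define z where "z = A *v w - c *\<^sub>R w"
  have zV: "z \<in> V" unfolding z_def using V w by (simp add: subspace_diff subspace_scale)
  have sym: "w \<bullet> (A *v z) = z \<bullet> (A *v w)"
    by (metis herm inner_adj inner_commute)
  have "2 * (z \<bullet> z) \<le> t * (c * (z \<bullet> z) - z \<bullet> (A *v z))" if "t > 0" for t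
  proof -
    have "w + t *\<^sub>R z \<in> V" using V w zV by (simp add: subspace_add subspace_scale)
    from max[OF this] have "t * (2 * (z \<bullet> (A *v w) - c * (z \<bullet> w))) \<le> t * (t * (c * (z \<bullet> z) - z \<bullet> (A *v z)))"
      using w sym by (simp add: cmat_vec.add_right cmat_vec.scaleR_right inner_add_left inner_add_right
          inner_commute[of w z] algebra_simps)
    moreover have "z \<bullet> (A *v w) - c * (z \<bullet> w) = z \<bullet> z"
      by (simp add: z_def algebra_simps inner_diff_right)
    ultimately show ?thesis using that by simp
  qed
  then have "eventually (\<lambda>t. 2 * (z \<bullet> z) \<le> t * (c * (z \<bullet> z) - z \<bullet> (A *v z))) (at_right 0)"
    by (auto simp: eventually_at_right_field intro: exI[of _ 1])
  moreover have "((\<lambda>t. t * (c * (z \<bullet> z) - z \<bullet> (A *v z))) \<longlongrightarrow> 0 * (c * (z \<bullet> z) - z \<bullet> (A *v z))) (at_right 0)"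
    by (intro tendsto_intros)
  ultimately have "2 * (z \<bullet> z) \<le> 0"
    using tendsto_lowerbound by fastforce
  then have "z = 0" by (metis inner_eq_zero_iff inner_ge_zero linorder_not_less mult_2 add_nonneg_nonneg add_pos_pos order_le_less)
  then show ?thesis by (simp add: z_def)
qed

text \<open>
  Fewer than \<open>n\<close> vectors together with their multiples by \<open>\<i>\<close> span less than the real dimension
  \<open>2 n\<close> of the whole space.
\<close>

lemma exists_cdot_orthogonal:
  fixes u :: "'n::finite \<Rightarrow> complex ^ 'n"
  assumes "I \<noteq> UNIV"
  obtains w where "w \<noteq> 0" "\<And>i. i \<in> I \<Longrightarrow> cdot (u i) w = 0"
proof -
  let ?S = "u ` I \<union> (\<lambda>i. \<i> *s u i) ` I"
  have fin: "finite I" by simp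
  have "dim ?S \<le> card ?S" by (rule dim_le_card') (use fin in auto)
  also have "\<dots> \<le> card (u ` I) + card ((\<lambda>i. \<i> *s u i) ` I)" by (rule card_Un_le)
  also have "\<dots> \<le> card I + card I" by (intro add_mono card_image_le fin)
  also have "\<dots> < 2 * CARD('n)"
    using assms psubset_card_mono[of UNIV I] by (simp add: psubset_eq)
  also have "\<dots> = DIM(complex ^ 'n)" by simp
  finally obtain w where "w \<noteq> 0" and w: "\<And>y. y \<in> span ?S \<Longrightarrow> orthogonal w y"
    using orthogonal_to_subspace_exists by blast
  have "cdot (u i) w = 0" if "i \<in> I" for i
  proof -
    have "u i \<in> span ?S" "\<i> *s u i \<in> span ?S" using that by (auto intro!: span_base)
    then have "u i \<bullet> w = 0" "(\<i> *s u i) \<bullet> w = 0"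
      using w by (metis orthogonal_def inner_commute)+
    then show ?thesis by (simp add: complex_eq_iff Re_cdot_ii inner_eq_Re_cdot)
  qed
  with \<open>w \<noteq> 0\<close> that show ?thesis by blast
qed

text \<open>
  Eigenvectors are added one at a time: the complement \<open>V\<close> of those already found is invariant,
  and the quadratic form has a maximizer on its unit sphere, which is again an eigenvector.
\<close>

lemma orthonormal_eigenvectors:
  fixes A :: "('n::finite) cmat" and I :: "'n set"
  assumes herm: "mat_adj A = A" and "finite I"
  shows "\<exists>u d. (\<forall>i\<in>I. A *v u i = d i *\<^sub>R u i \<and> norm (u i) = 1) \<and>
               (\<forall>i\<in>I. \<forall>j\<in>I. i \<noteq> j \<longrightarrow> cdot (u i) (u j) = 0)"
  using \<open>finite I\<close>
proof (induction I rule: finite_induct)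
  case empty
  then show ?case by simp
next
  case (insert k I)
  from insert.IH obtain u d where IH: "\<forall>i\<in>I. A *v u i = d i *\<^sub>R u i \<and> norm (u i) = 1"
      "\<forall>i\<in>I. \<forall>j\<in>I. i \<noteq> j \<longrightarrow> cdot (u i) (u j) = 0"
    by (elim exE conjE) (erule (1) that)
  have eig: "\<And>i. i \<in> I \<Longrightarrow> A *v u i = d i *\<^sub>R u i"
    and nrm: "\<And>i. i \<in> I \<Longrightarrow> norm (u i) = 1"
    and orth: "\<And>i j. i \<in> I \<Longrightarrow> j \<in> I \<Longrightarrow> i \<noteq> j \<Longrightarrow> cdot (u i) (u j) = 0"
    using IH by blast+
  define V where "V = {w. \<forall>i\<in>I. cdot (u i) w = 0}"
  have sub: "subspace V"
    by (auto simp: V_def subspace_def cdot_add_right cdot_scaleR_right cdot_zero_right)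
  have inv: "A *v w \<in> V" if "w \<in> V" for w
    using that by (auto simp: V_def eig cdot_adj[of A _ w, unfolded herm, symmetric] cdot_scaleR_left)
  define K where "K = V \<inter> sphere 0 1"
  have "closed V" using sub by (rule closed_subspace)
  then have "compact K" unfolding K_def by (simp add: closed_Int_compact)
  obtain w where "w \<noteq> 0" "w \<in> V"
  proof -
    have "I \<noteq> UNIV" using insert(2) by blast
    then obtain w where "w \<noteq> 0" "\<And>i. i \<in> I \<Longrightarrow> cdot (u i) w = 0"
      using exists_cdot_orthogonal by metis
    then show ?thesis using that by (simp add: V_def)
  qed
  then have "(1 / norm w) *\<^sub>R w \<in> K" using sub by (simp add: K_def subspace_scale)
  then have "K \<noteq> {}" by blast
  have cont: "continuous_on K (\<lambda>v. v \<bullet> (A *v v))"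
    by (intro continuous_intros cmat_vec.continuous_on)
  obtain x where x: "x \<in> K" "\<And>y. y \<in> K \<Longrightarrow> y \<bullet> (A *v y) \<le> x \<bullet> (A *v x)"
    using continuous_attains_sup[OF \<open>compact K\<close> \<open>K \<noteq> {}\<close> cont] by blast
  define c where "c = x \<bullet> (A *v x)"
  have nx: "norm x = 1" "x \<in> V" using x by (auto simp: K_def)
  have "A *v x = c *\<^sub>R x"
  proof (rule maximizer_eigenvector[OF herm sub inv])
    show "v \<bullet> (A *v v) \<le> c * (v \<bullet> v)" if "v \<in> V" for v
    proof (cases "v = 0")
      case False
      then have "(1 / norm v) *\<^sub>R v \<in> K" using sub that by (simp add: K_def subspace_scale)
      from x(2)[OF this] have "(v \<bullet> (A *v v)) / (norm v)\<^sup>2 \<le> c"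
        by (simp add: c_def cmat_vec.scaleR_right power2_eq_square)
      then show ?thesis using False by (simp add: power2_norm_eq_inner divide_le_eq)
    qed simp
    show "x \<bullet> (A *v x) = c * (x \<bullet> x)" using nx by (simp add: c_def dot_square_norm)
  qed (use nx in auto)
  moreover have "cdot (u i) x = 0" "cdot x (u i) = 0" if "i \<in> I" for i
    using nx that cdot_commute[of x "u i"] by (auto simp: V_def)
  ultimately have new: "A *v x = c *\<^sub>R x" "norm x = 1" "\<And>i. i \<in> I \<Longrightarrow> cdot (u i) x = 0"
      "\<And>i. i \<in> I \<Longrightarrow> cdot x (u i) = 0"
    using nx by blast+
  show ?case
  proof (intro exI conjI ballI impI)
    fix i assume i: "i \<in> insert k I"
    show "A *v (u(k := x)) i = (d(k := c)) i *\<^sub>R (u(k := x)) i" "norm ((u(k := x)) i) = 1"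
      using i eig[of i] nrm[of i] new(1,2) by (cases "i = k"; simp)+
    fix j assume "j \<in> insert k I" "i \<noteq> j"
    then show "cdot ((u(k := x)) i) ((u(k := x)) j) = 0"
      using i orth[of i j] new(3)[of i] new(4)[of j] by (cases "i = k"; cases "j = k"; simp)
  qed
qed

theorem hermitian_diagonalization:
  fixes A :: "('n::finite) cmat"
  assumes herm: "mat_adj A = A"
  obtains U d where "unitary_mat U" "A = U ** real_diag d ** mat_adj U"
proof -
  obtain u :: "'n \<Rightarrow> complex ^ 'n" and d where *: "\<forall>i\<in>UNIV. A *v u i = d i *\<^sub>R u i \<and> norm (u i) = 1"
      "\<forall>i\<in>UNIV. \<forall>j\<in>UNIV. i \<noteq> j \<longrightarrow> cdot (u i) (u j) = 0"
    using orthonormal_eigenvectors[OF herm finite[of UNIV]] by (elim exE conjE) (erule (1) that)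
  then have eig: "\<And>i. A *v u i = d i *\<^sub>R u i" and nrm: "\<And>i. norm (u i) = 1"
    and orth: "\<And>i j. i \<noteq> j \<Longrightarrow> cdot (u i) (u j) = 0"
    by blast+
  define U :: "'n cmat" where "U = (\<chi> i j. u j $ i)"
  have "(mat_adj U ** U) $ i $ j = cdot (u i) (u j)" for i j
    by (simp add: matrix_matrix_mult_def mat_adj_def U_def cdot_def)
  then have "mat_adj U ** U = mat 1"
    using orth by (auto simp: vec_eq_iff mat_def cdot_self nrm)
  then have U: "unitary_mat U"
    by (simp add: unitary_mat_def matrix_left_right_inverse)
  have "(A ** U) $ i $ j = (A *v u j) $ i" for i j
    by (simp add: matrix_matrix_mult_def matrix_vector_mult_def U_def)
  then have "A ** U = U ** real_diag d"
    by (simp add: vec_eq_iff real_diag_mult_right eig) (simp add: U_def scaleR_conv_of_real mult.commute)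
  then have "A = U ** real_diag d ** mat_adj U"
    using U by (metis matrix_mul_assoc matrix_mul_rid unitary_mat_def)
  with U that show ?thesis by blast
qed

lemma norm_unitary_mult_left:
  fixes A :: "('n::finite) cmat"
  assumes "unitary_mat U" shows "norm (U ** A) = norm A"
proof -
  have "mat_adj (U ** A) ** (U ** A) = mat_adj A ** (mat_adj U ** U) ** A"
    by (simp add: mat_adj_mult matrix_mul_assoc)
  also have "\<dots> = mat_adj A ** A" using assms by (simp add: unitary_mat_def)
  finally show ?thesis by (simp add: norm_eq_sqrt_inner inner_eq_trace)
qed

lemma norm_unitary_mult_right:
  fixes A :: "('n::finite) cmat"
  assumes "unitary_mat U" shows "norm (A ** U) = norm A"
proof -
  have "norm (A ** U) = norm (mat_adj U ** mat_adj A)"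
    by (simp only: norm_mat_adj flip: mat_adj_mult)
  then show ?thesis by (simp add: norm_unitary_mult_left unitary_mat_adj assms)
qed

lemma norm_matrix_sq: "(norm (M :: ('n::finite) cmat))\<^sup>2 = (\<Sum>i\<in>UNIV. \<Sum>j\<in>UNIV. (cmod (M $ i $ j))\<^sup>2)"
  by (simp add: norm_vec_def L2_set_def sum_nonneg)

section \<open>Lipschitz continuity of the functional calculus and of the absolute value\<close>

text \<open>
  Passing to the eigenbasis of the first matrix on the left and of the second on the right turns
  the difference into the matrix with entries \<open>(d i - e j) W i j\<close>, where \<open>W\<close> is the unitary change
  of basis.
\<close>

lemma norm_diff_diagonalized:
  assumes U: "unitary_mat U" and V: "unitary_mat V"
  shows "(norm (U ** real_diag d ** mat_adj U - V ** real_diag e ** mat_adj V))\<^sup>2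
    = (\<Sum>i\<in>UNIV. \<Sum>j\<in>UNIV. (d i - e j)\<^sup>2 * (cmod ((mat_adj U ** V) $ i $ j))\<^sup>2)"
proof -
  let ?A = "U ** real_diag d ** mat_adj U" and ?B = "V ** real_diag e ** mat_adj V"
  let ?W = "mat_adj U ** V"
  have "mat_adj U ** (?A - ?B) ** V = (mat_adj U ** U) ** real_diag d ** ?W - ?W ** real_diag e ** (mat_adj V ** V)"
    by (simp add: cmat_mult.diff_left cmat_mult.diff_right matrix_mul_assoc)
  also have "\<dots> = real_diag d ** ?W - ?W ** real_diag e"
    using U V by (simp add: unitary_mat_def)
  finally have "norm (mat_adj U ** (?A - ?B) ** V) = norm (real_diag d ** ?W - ?W ** real_diag e)"
    by (rule arg_cong)
  then have "norm (?A - ?B) = norm (real_diag d ** ?W - ?W ** real_diag e)"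
    by (simp only: norm_unitary_mult_right[OF V] norm_unitary_mult_left[OF unitary_mat_adj[OF U]])
  moreover have "(real_diag d ** ?W - ?W ** real_diag e) $ i $ j = of_real (d i - e j) * ?W $ i $ j" for i j
    by (simp add: real_diag_mult_left real_diag_mult_right algebra_simps)
  ultimately show ?thesis
    by (simp only: norm_matrix_sq norm_mult power_mult_distrib norm_of_real power2_abs)
qed

text \<open>
  In the Hilbert--Schmidt norm the functional calculus inherits the Lipschitz constant of the scalar
  function, because the weights in the formula for the norm of a difference do not depend on \<open>f\<close>.
\<close>

lemma herm_fun_lipschitz:
  assumes A: "mat_adj A = A" and B: "mat_adj B = B" and f: "L-lipschitz_on UNIV f"
  shows "norm (herm_fun f A - herm_fun f B) \<le> L * norm (A - B)"
proof -
  obtain U d where U: "unitary_mat U" "A = U ** real_diag d ** mat_adj U"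
    using hermitian_diagonalization[OF A] by blast
  obtain V e where V: "unitary_mat V" "B = V ** real_diag e ** mat_adj V"
    using hermitian_diagonalization[OF B] by blast
  have "0 \<le> L" using f by (rule lipschitz_on_nonneg)
  let ?w = "\<lambda>i j. (cmod ((mat_adj U ** V) $ i $ j))\<^sup>2"
  have sq: "(f x - f y)\<^sup>2 \<le> L\<^sup>2 * (x - y)\<^sup>2" for x y
  proof -
    have "\<bar>f x - f y\<bar> \<le> L * \<bar>x - y\<bar>"
      using lipschitz_onD[OF f, of x y] by (simp add: dist_real_def)
    then have "\<bar>f x - f y\<bar>\<^sup>2 \<le> (L * \<bar>x - y\<bar>)\<^sup>2" by (rule power_mono) simp
    then show ?thesis by (simp add: power_mult_distrib)
  qed
  have "(norm (herm_fun f A - herm_fun f B))\<^sup>2 = (\<Sum>i\<in>UNIV. \<Sum>j\<in>UNIV. (f (d i) - f (e j))\<^sup>2 * ?w i j)"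
    by (simp add: herm_fun_eq[OF U] herm_fun_eq[OF V] norm_diff_diagonalized[OF U(1) V(1)])
  also have "\<dots> \<le> (\<Sum>i\<in>UNIV. \<Sum>j\<in>UNIV. (L\<^sup>2 * (d i - e j)\<^sup>2) * ?w i j)"
    by (intro sum_mono mult_right_mono sq) simp
  also have "\<dots> = L\<^sup>2 * (norm (A - B))\<^sup>2"
    unfolding U(2) V(2) norm_diff_diagonalized[OF U(1) V(1)] by (simp add: sum_distrib_left mult.assoc)
  finally have "(norm (herm_fun f A - herm_fun f B))\<^sup>2 \<le> (L * norm (A - B))\<^sup>2"
    by (simp add: power_mult_distrib)
  then show ?thesis by (rule power2_le_imp_le) (use \<open>0 \<le> L\<close> in simp)
qed

lemma mat_abs_diagonalization:
  obtains U s where "unitary_mat U" "\<And>i. 0 \<le> s i"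
    "mat_adj X ** X = U ** real_diag (\<lambda>i. (s i)\<^sup>2) ** mat_adj U"
    "mat_abs X = U ** real_diag s ** mat_adj U"
proof -
  have "mat_adj (mat_adj X ** X) = mat_adj X ** X" by (simp add: mat_adj_mult)
  then obtain U d where U: "unitary_mat U" "mat_adj X ** X = U ** real_diag d ** mat_adj U"
    using hermitian_diagonalization by blast
  have "mat_adj (X ** U) ** (X ** U) = mat_adj U ** (mat_adj X ** X) ** U"
    by (simp add: mat_adj_mult matrix_mul_assoc)
  also have "\<dots> = (mat_adj U ** U) ** real_diag d ** (mat_adj U ** U)"
    unfolding U(2) by (simp only: matrix_mul_assoc)
  also have "\<dots> = real_diag d"
    using U(1) by (simp add: unitary_mat_def)
  finally have diag: "mat_adj (X ** U) ** (X ** U) = real_diag d" .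
  have "0 \<le> d i" for i
  proof -
    have "d i = Re ((mat_adj (X ** U) ** (X ** U)) $ i $ i)"
      unfolding diag by (simp add: real_diag_def)
    also have "\<dots> = (\<Sum>k\<in>UNIV. (cmod ((X ** U) $ k $ i))\<^sup>2)"
      unfolding matrix_matrix_mult_def[of "mat_adj (X ** U)"]
      by (simp add: mat_adj_def cmod_power2) (simp add: power2_eq_square)
    also have "\<dots> \<ge> 0" by (simp add: sum_nonneg)
    finally show ?thesis .
  qed
  then have "\<And>i. 0 \<le> sqrt (d i)" "d = (\<lambda>i. (sqrt (d i))\<^sup>2)" by auto
  moreover have "mat_abs X = U ** real_diag (\<lambda>i. sqrt (d i)) ** mat_adj U"
    using herm_fun_eq[OF U, of sqrt] by (simp add: mat_abs_def comp_def)
  ultimately show ?thesis using that[of U "\<lambda>i. sqrt (d i)"] U by metis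
qed

lemma mat_adj_mat_abs [simp]: "mat_adj (mat_abs X) = mat_abs X"
proof -
  obtain U s where "mat_abs X = U ** real_diag s ** mat_adj U"
    using mat_abs_diagonalization[of X] by metis
  then show ?thesis by (simp add: mat_adj_mult matrix_mul_assoc)
qed

text \<open>
  The left factor is \<open>V = X U D\<close> for the diagonal matrix \<open>D\<close> of the numbers \<open>1 / s i\<close>, with the
  convention \<open>1 / 0 = 0\<close>: its columns are the left singular vectors, and they vanish where the
  singular value does.  Hence \<open>V\<close> is a partial isometry.
\<close>

lemma polar_factorization:
  obtains U V s where "unitary_mat U" "\<And>i. 0 \<le> s i"
    "mat_abs X = U ** real_diag s ** mat_adj U"
    "X = V ** real_diag s ** mat_adj U"
    "mat_adj V ** V = real_diag (\<lambda>i. if s i = 0 then 0 else 1)"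
proof -
  obtain U s where U: "unitary_mat U" "\<And>i. 0 \<le> s i"
    "mat_adj X ** X = U ** real_diag (\<lambda>i. (s i)\<^sup>2) ** mat_adj U"
    "mat_abs X = U ** real_diag s ** mat_adj U"
    using mat_abs_diagonalization[of X] by metis
  have UU: "mat_adj U ** U = mat 1" "U ** mat_adj U = mat 1" using U(1) by (auto simp: unitary_mat_def)
  define V where "V = X ** U ** real_diag (\<lambda>i. 1 / s i)"
  let ?C = "X ** U"
  have "mat_adj ?C ** ?C = mat_adj U ** (mat_adj X ** X) ** U"
    by (simp add: mat_adj_mult matrix_mul_assoc)
  also have "\<dots> = (mat_adj U ** U) ** real_diag (\<lambda>i. (s i)\<^sup>2) ** (mat_adj U ** U)"
    unfolding U(3) by (simp only: matrix_mul_assoc)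
  finally have CC: "mat_adj ?C ** ?C = real_diag (\<lambda>i. (s i)\<^sup>2)" by (simp add: UU)
  have zero: "?C $ k $ i = 0" if "s i = 0" for i k
  proof -
    have "0 = Re ((mat_adj ?C ** ?C) $ i $ i)" unfolding CC using that by (simp add: real_diag_def)
    also have "\<dots> = (\<Sum>k\<in>UNIV. (cmod (?C $ k $ i))\<^sup>2)"
      unfolding matrix_matrix_mult_def[of "mat_adj ?C"]
      by (simp add: mat_adj_def cmod_power2) (simp add: power2_eq_square)
    finally show ?thesis by (simp add: sum_nonneg_eq_0_iff)
  qed
  have "V ** real_diag s = ?C"
    by (auto simp: V_def vec_eq_iff real_diag_mult_right zero)
  then have "X = V ** real_diag s ** mat_adj U"
    by (metis UU(2) matrix_mul_assoc matrix_mul_rid)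
  moreover have "mat_adj V ** V = real_diag (\<lambda>i. 1 / s i) ** (mat_adj ?C ** ?C) ** real_diag (\<lambda>i. 1 / s i)"
    by (simp add: V_def mat_adj_mult matrix_mul_assoc)
  then have "mat_adj V ** V = real_diag (\<lambda>i. if s i = 0 then 0 else 1)"
    unfolding CC by (auto simp: vec_eq_iff real_diag_mult_left real_diag_mult_right)
      (auto simp: real_diag_def power2_eq_square)
  ultimately show ?thesis using that U by blast
qed

lemma inner_sandwich_self:
  assumes A: "mat_adj A ** A = real_diag p" and B: "mat_adj B ** B = real_diag q"
    and one: "\<And>i. s i \<noteq> 0 \<Longrightarrow> p i = 1 \<and> q i = 1"
  shows "(A ** real_diag s ** mat_adj B) \<bullet> (A ** real_diag s ** mat_adj B) = (\<Sum>i\<in>UNIV. (s i)\<^sup>2)"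
proof -
  have "(\<Sum>j\<in>UNIV. s i * s j * Re (real_diag p $ i $ j * cnj (real_diag q $ i $ j)))
     = (\<Sum>j\<in>UNIV. if i = j then (s i)\<^sup>2 else 0)" for i
    using one[of i] by (intro sum.cong refl, cases "s i = 0") (auto simp: real_diag_def power2_eq_square)
  then show ?thesis unfolding inner_sandwich A B by simp
qed

text \<open>
  The bound of Araki and Yamagami.  Write \<open>X = V S U*\<close> and \<open>Y = V' S' U'*\<close>.  The inner product of
  \<open>X\<close> and \<open>Y\<close> pairs the overlaps of the left factors with those of the right factors, while
  \<open>|X| = U S U*\<close> and the companion \<open>P = V S V*\<close> (likewise \<open>|Y|\<close> and \<open>Q\<close>) produce the squares of
  the right and of the left overlaps.  The arithmetic-geometric mean inequality gives
  \<open>2 X \<bullet> Y \<le> P \<bullet> Q + |X| \<bullet> |Y|\<close>, and as \<open>P\<close> and \<open>|X|\<close> have the norm of \<open>X\<close>, the squared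
  distances from \<open>|X|\<close> to \<open>|Y|\<close> and from \<open>P\<close> to \<open>Q\<close> add up to at most twice that from \<open>X\<close> to \<open>Y\<close>.
\<close>

lemma mat_abs_lipschitz: "norm (mat_abs X - mat_abs Y) \<le> sqrt 2 * norm (X - Y)"
proof -
  obtain U V s where X: "unitary_mat U" "\<And>i. 0 \<le> s i"
    "mat_abs X = U ** real_diag s ** mat_adj U" "X = V ** real_diag s ** mat_adj U"
    "mat_adj V ** V = real_diag (\<lambda>i. if s i = 0 then 0 else 1)"
    using polar_factorization[of X] by metis
  obtain U' V' t where Y: "unitary_mat U'" "\<And>i. 0 \<le> t i"
    "mat_abs Y = U' ** real_diag t ** mat_adj U'" "Y = V' ** real_diag t ** mat_adj U'"
    "mat_adj V' ** V' = real_diag (\<lambda>i. if t i = 0 then 0 else 1)"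
    using polar_factorization[of Y] by metis
  define P where "P = V ** real_diag s ** mat_adj V"
  define Q where "Q = V' ** real_diag t ** mat_adj V'"
  have UU: "mat_adj U ** U = mat 1" "mat_adj U' ** U' = mat 1"
    using X Y by (auto simp: unitary_mat_def)
  have one: "mat 1 = real_diag (\<lambda>i. 1)"
    by (simp add: mat_def real_diag_def vec_eq_iff)
  have "mat_abs X \<bullet> mat_abs X = (\<Sum>i\<in>UNIV. (s i)\<^sup>2)"
    unfolding X(3) by (rule inner_sandwich_self[OF UU(1)[unfolded one] UU(1)[unfolded one]]) simp
  moreover have "P \<bullet> P = (\<Sum>i\<in>UNIV. (s i)\<^sup>2)"
    unfolding P_def by (rule inner_sandwich_self[OF X(5) X(5)]) simp
  moreover have "X \<bullet> X = (\<Sum>i\<in>UNIV. (s i)\<^sup>2)"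
    by (subst (1 2) X(4), rule inner_sandwich_self[OF X(5) UU(1)[unfolded one]]) simp
  ultimately have sq: "mat_abs X \<bullet> mat_abs X = X \<bullet> X" "P \<bullet> P = X \<bullet> X" by simp_all
  have "mat_abs Y \<bullet> mat_abs Y = (\<Sum>i\<in>UNIV. (t i)\<^sup>2)"
    unfolding Y(3) by (rule inner_sandwich_self[OF UU(2)[unfolded one] UU(2)[unfolded one]]) simp
  moreover have "Q \<bullet> Q = (\<Sum>i\<in>UNIV. (t i)\<^sup>2)"
    unfolding Q_def by (rule inner_sandwich_self[OF Y(5) Y(5)]) simp
  moreover have "Y \<bullet> Y = (\<Sum>i\<in>UNIV. (t i)\<^sup>2)"
    by (subst (1 2) Y(4), rule inner_sandwich_self[OF Y(5) UU(2)[unfolded one]]) simp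
  ultimately have sq': "mat_abs Y \<bullet> mat_abs Y = Y \<bullet> Y" "Q \<bullet> Q = Y \<bullet> Y" by simp_all
  have amgm: "2 * Re (z * cnj w) \<le> (cmod z)\<^sup>2 + (cmod w)\<^sup>2" for z w
    using zero_le_power2[of "Re z - Re w"] zero_le_power2[of "Im z - Im w"]
    by (simp add: cmod_power2 power2_diff algebra_simps)
  have "2 * (X \<bullet> Y) \<le> P \<bullet> Q + mat_abs X \<bullet> mat_abs Y"
  proof -
    let ?M = "\<lambda>i j. (mat_adj V ** V') $ i $ j" and ?N = "\<lambda>i j. (mat_adj U ** U') $ i $ j"
    have "2 * (X \<bullet> Y) = (\<Sum>i\<in>UNIV. \<Sum>j\<in>UNIV. s i * t j * (2 * Re (?M i j * cnj (?N i j))))"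
      unfolding X(4) Y(4) inner_sandwich sum_distrib_left by (simp add: algebra_simps)
    also have "\<dots> \<le> (\<Sum>i\<in>UNIV. \<Sum>j\<in>UNIV. s i * t j * ((cmod (?M i j))\<^sup>2 + (cmod (?N i j))\<^sup>2))"
      using X(2) Y(2) by (intro sum_mono mult_left_mono amgm) simp
    also have "\<dots> = P \<bullet> Q + mat_abs X \<bullet> mat_abs Y"
      unfolding P_def Q_def X(3) Y(3) inner_sandwich complex_mult_cnj cmod_power2
      by (simp add: sum.distrib algebra_simps)
    finally show ?thesis .
  qed
  moreover have "0 \<le> (P - Q) \<bullet> (P - Q)" by simp
  ultimately have "(mat_abs X - mat_abs Y) \<bullet> (mat_abs X - mat_abs Y) \<le> 2 * ((X - Y) \<bullet> (X - Y))"
    using sq sq' by (simp add: inner_diff_left inner_diff_right inner_commute)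
  then have "(norm (mat_abs X - mat_abs Y))\<^sup>2 \<le> (sqrt 2 * norm (X - Y))\<^sup>2"
    by (simp add: power2_norm_eq_inner power_mult_distrib)
  then show ?thesis by (rule power2_le_imp_le) simp
qed

section \<open>Eigenvectors, quadratic forms and singular values\<close>

lemma real_diag_vec: "(real_diag d *v y) $ i = of_real (d i) * y $ i"
proof -
  have "(\<Sum>k\<in>UNIV. (if i = k then complex_of_real (d i) else 0) * y $ k)
      = (\<Sum>k\<in>UNIV. if i = k then of_real (d i) * y $ k else 0)"
    by (intro sum.cong) auto
  then show ?thesis by (simp add: matrix_vector_mult_def real_diag_def)
qed

lemma herm_fun_eigenvector:
  assumes A: "mat_adj A = A" and v: "A *v v = c *\<^sub>R v"
  shows "herm_fun f A *v v = f c *\<^sub>R v"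
proof -
  obtain U d where U: "unitary_mat U" "A = U ** real_diag d ** mat_adj U"
    using hermitian_diagonalization[OF A] by blast
  let ?y = "mat_adj U *v v"
  have Uy: "U *v ?y = v" using U(1) by (simp add: matrix_vector_mul_assoc unitary_mat_def)
  have "mat_adj U *v (A *v v) = (mat_adj U ** U) *v (real_diag d *v ?y)"
    unfolding U(2) by (simp only: matrix_vector_mul_assoc matrix_mul_assoc)
  then have "real_diag d *v ?y = c *\<^sub>R ?y"
    using U(1) by (simp add: v unitary_mat_def cmat_vec.scaleR_right)
  then have eq: "of_real (d i) * ?y $ i = of_real c * ?y $ i" for i
    by (metis real_diag_vec scaleR_conv_of_real vector_scaleR_component)
  have "of_real (f (d i)) * ?y $ i = of_real (f c) * ?y $ i" for i
    using eq[of i] by (cases "?y $ i = 0") auto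
  then have "real_diag (f \<circ> d) *v ?y = f c *\<^sub>R ?y"
    by (simp add: vec_eq_iff real_diag_vec) (simp add: scaleR_conv_of_real)
  moreover have "herm_fun f A *v v = U *v (real_diag (f \<circ> d) *v ?y)"
    by (simp only: herm_fun_eq[OF U] matrix_vector_mul_assoc matrix_mul_assoc)
  ultimately show ?thesis by (simp add: cmat_vec.scaleR_right Uy)
qed

lemma norm_vec_sq: "(norm (v :: complex ^ ('n::finite)))\<^sup>2 = (\<Sum>i\<in>UNIV. (cmod (v $ i))\<^sup>2)"
  by (simp add: norm_vec_def L2_set_def sum_nonneg)

lemma quadratic_form_diagonalized:
  "v \<bullet> ((U ** real_diag d ** mat_adj U) *v v) = (\<Sum>i\<in>UNIV. d i * (cmod ((mat_adj U *v v) $ i))\<^sup>2)"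
proof -
  let ?y = "mat_adj U *v v"
  have "v \<bullet> ((U ** real_diag d ** mat_adj U) *v v) = ?y \<bullet> (real_diag d *v ?y)"
    by (simp add: inner_adj flip: matrix_vector_mul_assoc)
  also have "\<dots> = (\<Sum>i\<in>UNIV. d i * (cmod (?y $ i))\<^sup>2)"
    by (simp add: inner_vec_def real_diag_vec flip: scaleR_conv_of_real power2_norm_eq_inner)
  finally show ?thesis .
qed

lemma norm_sq_unitary_coordinates:
  assumes "unitary_mat U"
  shows "(norm v)\<^sup>2 = (\<Sum>i\<in>UNIV. (cmod ((mat_adj U *v v) $ i))\<^sup>2)"
  using unitary_norm[OF unitary_mat_adj[OF assms], of v] norm_vec_sq[of "mat_adj U *v v"] by simp

lemma mat_spectrum_eq: "mat_spectrum A = {z. \<exists>v. v \<noteq> 0 \<and> A *v v = z *s v}"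
proof -
  have "invertible M \<longleftrightarrow> (\<forall>v. M *v v = 0 \<longrightarrow> v = 0)" for M :: "'a cmat"
    by (simp add: invertible_left_inverse matrix_left_invertible_ker)
  moreover have "(A - mat z) *v v = A *v v - z *s v" for z v
  proof -
    have "(\<Sum>j\<in>UNIV. (if i = j then z else 0) * v $ j) = (\<Sum>j\<in>UNIV. if i = j then z * v $ j else 0)" for i
      by (intro sum.cong) auto
    then have "mat z *v v = z *s v" by (simp add: vec_eq_iff matrix_vector_mult_def mat_def)
    then show ?thesis by (simp add: matrix_vector_mult_diff_rdistrib)
  qed
  ultimately show ?thesis by (auto simp: mat_spectrum_def)
qed

lemma mat_spectrum_diagonalized:
  assumes U: "unitary_mat U"
  shows "mat_spectrum (U ** real_diag d ** mat_adj U) = of_real ` range d"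
proof (intro equalityI subsetI)
  let ?A = "U ** real_diag d ** mat_adj U"
  have UU: "mat_adj U ** U = mat 1" "U ** mat_adj U = mat 1" using U by (auto simp: unitary_mat_def)
  {
    fix z assume "z \<in> mat_spectrum ?A"
    then obtain v where v: "v \<noteq> 0" "?A *v v = z *s v" by (auto simp: mat_spectrum_eq)
    let ?y = "mat_adj U *v v"
    have "U *v ?y = v" by (simp add: matrix_vector_mul_assoc UU)
    then have "?y \<noteq> 0" using v(1) by (metis cmat_vec.zero_right)
    then obtain i where i: "?y $ i \<noteq> 0" by (metis vec_eq_iff zero_index)
    have "mat_adj U *v (?A *v v) = (mat_adj U ** U) *v (real_diag d *v ?y)"
      by (simp only: matrix_vector_mul_assoc matrix_mul_assoc)
    then have "real_diag d *v ?y = z *s ?y"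
      by (simp add: v UU vector_scalar_commute)
    then have "of_real (d i) * ?y $ i = z * ?y $ i"
      by (metis real_diag_vec vector_smult_component)
    then show "z \<in> of_real ` range d" using i by auto
  next
    fix z assume "z \<in> complex_of_real ` range d"
    then obtain i where i: "z = of_real (d i)" by auto
    let ?v = "U *v axis i 1"
    have "norm ?v = 1" by (simp add: unitary_norm[OF U] norm_axis_1)
    then have "?v \<noteq> 0" by auto
    moreover have "?A *v ?v = U *v (real_diag d *v ((mat_adj U ** U) *v axis i 1))"
      by (simp only: matrix_vector_mul_assoc matrix_mul_assoc)
    moreover have "real_diag d *v axis i 1 = z *s axis i 1"
      by (simp add: vec_eq_iff real_diag_vec i axis_def)
    ultimately have "?v \<noteq> 0 \<and> ?A *v ?v = z *s ?v" by (simp add: UU vector_scalar_commute)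
    then show "z \<in> mat_spectrum ?A" unfolding mat_spectrum_eq by blast
  }
qed

lemma mat_interval_singular_values:
  assumes "X \<in> mat_interval a b" "unitary_mat U" "mat_abs X = U ** real_diag s ** mat_adj U"
  shows "s i \<in> {a..b}"
proof -
  have "range s \<subseteq> {a..b}"
    using assms by (simp add: mat_interval_def mat_spectrum_diagonalized inj_image_subset_iff inj_of_real)
  then show ?thesis by blast
qed

text \<open>
  The smallest and the largest singular value are the extreme factors by which \<open>X\<close> stretches a
  vector.  This form of membership is the one that a differential equation can preserve.
\<close>

lemma mat_interval_iff:
  assumes "0 \<le> a"
  shows "X \<in> mat_interval a b \<longleftrightarrow> (\<forall>v. a * norm v \<le> norm (X *v v) \<and> norm (X *v v) \<le> b * norm v)"
proof -
  obtain U s where U: "unitary_mat U" "\<And>i. 0 \<le> s i"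
    "mat_adj X ** X = U ** real_diag (\<lambda>i. (s i)\<^sup>2) ** mat_adj U"
    "mat_abs X = U ** real_diag s ** mat_adj U"
    using mat_abs_diagonalization[of X] by metis
  have nX: "(norm (X *v v))\<^sup>2 = (\<Sum>i\<in>UNIV. (s i)\<^sup>2 * (cmod ((mat_adj U *v v) $ i))\<^sup>2)" for v
    by (simp only: norm_mult_sq U(3) quadratic_form_diagonalized)
  have "X \<in> mat_interval a b \<longleftrightarrow> (\<forall>i. s i \<in> {a..b})"
    by (simp only: mat_interval_def mem_Collect_eq U(4) mat_spectrum_diagonalized[OF U(1)]
        inj_image_subset_iff[OF inj_of_real]) (simp add: image_subset_iff)
  also have "\<dots> \<longleftrightarrow> (\<forall>v. a * norm v \<le> norm (X *v v) \<and> norm (X *v v) \<le> b * norm v)"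
  proof (intro iffI allI)
    fix v assume s: "\<forall>i. s i \<in> {a..b}"
    then have "a \<le> s undefined" "s undefined \<le> b" by auto
    then have "0 \<le> b" using assms by linarith
    have "(a * norm v)\<^sup>2 = (\<Sum>i\<in>UNIV. a\<^sup>2 * (cmod ((mat_adj U *v v) $ i))\<^sup>2)"
      by (simp add: power_mult_distrib norm_sq_unitary_coordinates[OF U(1)] sum_distrib_left)
    also have "\<dots> \<le> (norm (X *v v))\<^sup>2"
      unfolding nX using s assms by (intro sum_mono mult_right_mono power_mono) auto
    finally have 1: "a * norm v \<le> norm (X *v v)" by (rule power2_le_imp_le) simp
    have "(norm (X *v v))\<^sup>2 \<le> (\<Sum>i\<in>UNIV. b\<^sup>2 * (cmod ((mat_adj U *v v) $ i))\<^sup>2)"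
      unfolding nX using s U(2) by (intro sum_mono mult_right_mono power_mono) auto
    also have "\<dots> = (b * norm v)\<^sup>2"
      by (simp add: power_mult_distrib norm_sq_unitary_coordinates[OF U(1)] sum_distrib_left)
    finally have 2: "norm (X *v v) \<le> b * norm v" by (rule power2_le_imp_le) (use \<open>0 \<le> b\<close> in simp)
    show "a * norm v \<le> norm (X *v v) \<and> norm (X *v v) \<le> b * norm v" using 1 2 by blast
  next
    fix i assume *: "\<forall>v. a * norm v \<le> norm (X *v v) \<and> norm (X *v v) \<le> b * norm v"
    let ?v = "U *v axis i 1"
    have 1: "norm ?v = 1" by (simp add: unitary_norm[OF U(1)] norm_axis_1)
    have "mat_adj U *v ?v = axis i 1"
      using U(1) by (simp add: matrix_vector_mul_assoc unitary_mat_def)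
    then have "(norm (X *v ?v))\<^sup>2 = (\<Sum>j\<in>UNIV. if j = i then (s i)\<^sup>2 else 0)"
      unfolding nX by (intro sum.cong) (auto simp: axis_def)
    then have "norm (X *v ?v) = s i" using U(2) by simp
    then show "s i \<in> {a..b}" using *[rule_format, of ?v] 1 by simp
  qed
  finally show ?thesis .
qed

text \<open>
  The upper bound is duality.  For \<open>a > 0\<close> the lower bound makes \<open>X\<close> invertible, so \<open>v\<close> can be
  written as \<open>X w\<close> and the estimate for \<open>w\<close> is transported by Cauchy--Schwarz.
\<close>

lemma mat_interval_adj:
  assumes a: "0 \<le> a" and X: "X \<in> mat_interval a b"
  shows "mat_adj X \<in> mat_interval a b"
  unfolding mat_interval_iff[OF a]
proof (intro allI conjI)
  fix v
  have lo: "a * norm w \<le> norm (X *v w)" and hi: "norm (X *v w) \<le> b * norm w" for w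
    using X by (auto simp: mat_interval_iff[OF a])
  show "norm (mat_adj X *v v) \<le> b * norm v"
  proof (cases "mat_adj X *v v = 0")
    case True
    have "0 \<le> b * norm v" using hi[of v] norm_ge_zero order_trans by blast
    with True show ?thesis by simp
  next
    case False
    let ?w = "mat_adj X *v v"
    have "norm ?w * norm ?w = v \<bullet> (X *v ?w)"
      by (metis inner_adj' power2_eq_square power2_norm_eq_inner)
    also have "\<dots> \<le> norm v * norm (X *v ?w)" by (rule norm_cauchy_schwarz)
    also have "\<dots> \<le> norm v * (b * norm ?w)" by (intro mult_left_mono hi) simp
    finally show ?thesis using False by (simp add: mult.commute mult.left_commute)
  qed
  show "a * norm v \<le> norm (mat_adj X *v v)"
  proof (cases "a = 0 \<or> v = 0")
    case True then show ?thesis by auto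
  next
    case False
    then have "a > 0" "v \<noteq> 0" using a by auto
    have "w = 0" if "X *v w = 0" for w
      using lo[of w] that \<open>a > 0\<close> by (simp add: mult_le_0_iff)
    then obtain B where "B ** X = mat 1" using matrix_left_invertible_ker by blast
    then have "X ** B = mat 1" by (simp add: matrix_left_right_inverse)
    then have v: "X *v (B *v v) = v" by (simp add: matrix_vector_mul_assoc)
    let ?w = "B *v v"
    have "?w \<noteq> 0" using v \<open>v \<noteq> 0\<close> by (metis cmat_vec.zero_right)
    have "a * norm ?w * norm v \<le> norm v * norm v" using lo[of ?w] v by (simp add: mult_right_mono)
    also have "\<dots> = (mat_adj X *v v) \<bullet> ?w"
      by (simp add: inner_adj v flip: power2_norm_eq_inner power2_eq_square)
    also have "\<dots> \<le> norm (mat_adj X *v v) * norm ?w" by (rule norm_cauchy_schwarz)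
    finally show ?thesis using \<open>?w \<noteq> 0\<close> by (simp add: mult.commute mult.left_commute)
  qed
qed

lemma herm_fun_mat_abs_cong:
  assumes X: "X \<in> mat_interval a b" and fg: "\<And>x. x \<in> {a..b} \<Longrightarrow> f x = g x"
  shows "herm_fun f (mat_abs X) = herm_fun g (mat_abs X)"
proof -
  obtain U s where U: "unitary_mat U" "mat_abs X = U ** real_diag s ** mat_adj U"
    using mat_abs_diagonalization[of X] by metis
  have "f \<circ> s = g \<circ> s" using mat_interval_singular_values[OF X U] fg by auto
  then show ?thesis by (simp add: herm_fun_eq[OF U])
qed

lemma herm_fun_mat_abs_le:
  assumes X: "X \<in> mat_interval a b" and f: "\<And>x. x \<in> {a..b} \<Longrightarrow> f x \<le> c"
  shows "v \<bullet> (herm_fun f (mat_abs X) *v v) \<le> c * (norm v)\<^sup>2"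
proof -
  obtain U s where U: "unitary_mat U" "mat_abs X = U ** real_diag s ** mat_adj U"
    using mat_abs_diagonalization[of X] by metis
  show ?thesis
    unfolding herm_fun_eq[OF U] quadratic_form_diagonalized norm_sq_unitary_coordinates[OF U(1)] sum_distrib_left
    using mat_interval_singular_values[OF X U] f by (intro sum_mono mult_right_mono) auto
qed

lemma herm_fun_mat_abs_eigenvector:
  assumes v: "(mat_adj X ** X) *v v = s\<^sup>2 *\<^sub>R v" and s: "0 \<le> s"
  shows "herm_fun f (mat_abs X) *v v = f s *\<^sub>R v"
proof (rule herm_fun_eigenvector)
  show "mat_abs X *v v = s *\<^sub>R v"
    using herm_fun_eigenvector[OF _ v, of sqrt] s by (simp add: mat_abs_def mat_adj_mult)
qed simp

text \<open>
  Half the derivative of the squared length of \<open>Y v\<close> along the flow is the inner product below.  As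
  \<open>v\<close> is an eigenvector of \<open>|Y|\<close> and \<open>Y v\<close> one of \<open>|Y*|\<close> for the value \<open>s\<close> (or zero), two of the four
  terms of the commutator are explicit and contribute \<open>- (f1 s + f2 s) s\<^sup>2\<close> for a unit vector \<open>v\<close>.
  The other two are the quadratic form of \<open>f1 |Y|\<close> at \<open>Y v\<close> and \<open>s\<^sup>2\<close> times that of \<open>f2 |Y*|\<close> at
  \<open>v\<close>; when \<open>f1\<close> and \<open>f2\<close> are largest at \<open>s\<close>, they are at most \<open>f1 s s\<^sup>2\<close> and \<open>f2 s s\<^sup>2\<close>.
\<close>

lemma singular_vector_derivative_nonpos:
  assumes a: "0 \<le> a" and Y: "Y \<in> mat_interval a b"
    and eig: "(mat_adj Y ** Y) *v v = s\<^sup>2 *\<^sub>R v" and s: "0 \<le> s"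
    and f1: "\<And>x. x \<in> {a..b} \<Longrightarrow> f1 x \<le> f1 s" and f2: "\<And>x. x \<in> {a..b} \<Longrightarrow> f2 x \<le> f2 s"
  shows "(Y *v v) \<bullet> (commutator (phi_mat f1 f2 Y) Y *v v) \<le> 0"
proof -
  let ?P = "herm_fun f1 (mat_abs Y)" and ?Q = "herm_fun f2 (mat_abs (mat_adj Y))"
  let ?w = "Y *v v"
  have Pv: "?P *v v = f1 s *\<^sub>R v" using eig s by (rule herm_fun_mat_abs_eigenvector)
  have "(mat_adj (mat_adj Y) ** mat_adj Y) *v ?w = Y *v ((mat_adj Y ** Y) *v v)"
    by (simp only: matrix_vector_mul_assoc mat_adj_adj matrix_mul_assoc)
  then have Qw: "?Q *v ?w = f2 s *\<^sub>R ?w"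
    using s by (intro herm_fun_mat_abs_eigenvector) (simp_all add: eig cmat_vec.scaleR_right)
  have n: "(norm ?w)\<^sup>2 = s\<^sup>2 * (norm v)\<^sup>2"
    unfolding norm_mult_sq eig by (simp add: power2_norm_eq_inner)
  have "commutator (phi_mat f1 f2 Y) Y *v v = ?P *v ?w - ?Q *v ?w - Y *v (?P *v v) + Y *v (?Q *v v)"
    by (simp add: commutator_def phi_mat_def cmat_vec.diff_left cmat_mult.diff_left cmat_mult.diff_right
        matrix_vector_mul_assoc)
  then have "?w \<bullet> (commutator (phi_mat f1 f2 Y) Y *v v)
      = ?w \<bullet> (?P *v ?w) - (f1 s + f2 s) * (norm ?w)\<^sup>2 + (mat_adj Y *v ?w) \<bullet> (?Q *v v)"
    using inner_adj'[of ?w Y "?Q *v v"]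
    by (simp add: Pv Qw inner_diff_right inner_add_right cmat_vec.scaleR_right power2_norm_eq_inner
        ring_distribs)
  also have "(mat_adj Y *v ?w) \<bullet> (?Q *v v) = s\<^sup>2 * (v \<bullet> (?Q *v v))"
    by (simp add: matrix_vector_mul_assoc eig)
  also have "?w \<bullet> (?P *v ?w) - (f1 s + f2 s) * (norm ?w)\<^sup>2 + s\<^sup>2 * (v \<bullet> (?Q *v v))
     \<le> f1 s * (norm ?w)\<^sup>2 - (f1 s + f2 s) * (norm ?w)\<^sup>2 + s\<^sup>2 * (f2 s * (norm v)\<^sup>2)"
    by (intro add_mono diff_mono mult_left_mono order.refl herm_fun_mat_abs_le[OF Y]
        herm_fun_mat_abs_le[OF mat_interval_adj[OF a Y]] f1 f2) auto
  also have "\<dots> = 0" by (simp add: n algebra_simps)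
  finally show ?thesis .
qed

section \<open>A maximum principle and ordinary differential equations\<close>

text \<open>
  If \<open>G t v\<close> has no positive time derivative at the points \<open>v\<close> that maximize it over \<open>K\<close>, then its
  maximum over \<open>K\<close> does not grow.  Only the derivative for fixed \<open>v\<close> is involved, so the maximum
  itself, which need not be differentiable, is never differentiated: after subtracting
  \<open>\<epsilon> t\<close>, a maximum over time and \<open>K\<close> together can only be attained at time \<open>0\<close>.
\<close>

lemma maximum_principle:
  fixes G :: "real \<Rightarrow> 'v::topological_space \<Rightarrow> real"
  assumes K: "compact K" and cont: "continuous_on ({0..} \<times> K) (\<lambda>(t, v). G t v)"
    and der: "\<And>t v. t > 0 \<Longrightarrow> v \<in> K \<Longrightarrow> (\<And>w. w \<in> K \<Longrightarrow> G t w \<le> G t v) \<Longrightarrow>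
      \<exists>D\<le>0. ((\<lambda>s. G s v) has_real_derivative D) (at t within {0..})"
    and init: "\<And>w. w \<in> K \<Longrightarrow> G 0 w \<le> c"
    and tw: "0 \<le> t" "w \<in> K"
  shows "G t w \<le> c"
proof (rule field_le_epsilon)
  fix e :: real assume "e > 0"
  \<comment> \<open>The slope is chosen so that the correction up to time \<open>t\<close> costs at most \<open>e\<close>.\<close>
  define \<epsilon> where "\<epsilon> = e / (t + 1)"
  have "\<epsilon> > 0" "\<epsilon> * t \<le> e" using \<open>e > 0\<close> tw by (auto simp: \<epsilon>_def field_simps)
  define H where "H = (\<lambda>(s, v). G s v - \<epsilon> * s)"
  have "compact ({0..t} \<times> K)" using K by (intro compact_Times) auto
  moreover have "{0..t} \<times> K \<noteq> {}" using tw by auto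
  moreover have "continuous_on ({0..t} \<times> K) H"
  proof -
    have "continuous_on ({0..t} \<times> K) (\<lambda>p. (\<lambda>(t, v). G t v) p - \<epsilon> * fst p)"
      by (intro continuous_intros continuous_on_subset[OF cont]) auto
    then show ?thesis by (simp add: H_def case_prod_unfold)
  qed
  ultimately obtain p where p: "p \<in> {0..t} \<times> K" "\<And>q. q \<in> {0..t} \<times> K \<Longrightarrow> H q \<le> H p"
    using continuous_attains_sup by metis
  obtain s v where sv: "p = (s, v)" by fastforce
  have s: "0 \<le> s" "s \<le> t" "v \<in> K" using p sv by auto
  have max: "G s' v' - \<epsilon> * s' \<le> G s v - \<epsilon> * s" if "0 \<le> s'" "s' \<le> t" "v' \<in> K" for s' v'
    using p(2)[of "(s', v')"] that by (simp add: sv H_def)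
  have "s = 0"
  proof (rule ccontr)
    assume "s \<noteq> 0"
    then have "s > 0" using s by simp
    have "G s w' \<le> G s v" if "w' \<in> K" for w' using max[of s w'] s that by simp
    from der[OF \<open>s > 0\<close> \<open>v \<in> K\<close> this] obtain D
      where D: "D \<le> 0" "((\<lambda>s. G s v) has_real_derivative D) (at s within {0..})" by blast
    have "((\<lambda>s. G s v - \<epsilon> * s) has_real_derivative D - \<epsilon>) (at s within {0..})"
      using D(2) by (auto intro!: derivative_eq_intros)
    from has_real_derivative_neg_dec_left[OF this] D(1) \<open>\<epsilon> > 0\<close>
    obtain d where d: "d > 0"
      "\<And>h. h > 0 \<Longrightarrow> s - h \<in> {0..} \<Longrightarrow> h < d \<Longrightarrow> G s v - \<epsilon> * s < G (s - h) v - \<epsilon> * (s - h)"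
      by auto
    define h where "h = min (d / 2) s"
    have "h > 0" "h < d" "h \<le> s" using \<open>d > 0\<close> \<open>s > 0\<close> by (auto simp: h_def)
    then show False using d(2)[of h] max[of "s - h" v] s by auto
  qed
  then have "G t w - \<epsilon> * t \<le> c" using max[of t w] init[OF s(3)] tw by simp
  then show "G t w \<le> c + e" using \<open>\<epsilon> * t \<le> e\<close> by simp
qed

text \<open>
  Gronwall's argument: \<open>exp (- 2 L t)\<close> times the squared distance of two solutions has a derivative
  that is nowhere positive.  The maximum principle over a one-point set concludes.
\<close>

lemma lipschitz_ode_unique:
  fixes F :: "'a::real_inner \<Rightarrow> 'a"
  assumes F: "L-lipschitz_on S F"
    and X: "\<And>t. t \<ge> 0 \<Longrightarrow> X t \<in> S" "\<And>t. t \<ge> 0 \<Longrightarrow> (X has_vector_derivative F (X t)) (at t within {0..})"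
    and Y: "\<And>t. t \<ge> 0 \<Longrightarrow> Y t \<in> S" "\<And>t. t \<ge> 0 \<Longrightarrow> (Y has_vector_derivative F (Y t)) (at t within {0..})"
    and init: "X 0 = Y 0" and "0 \<le> t"
  shows "X t = Y t"
proof -
  \<comment> \<open>The second argument is a dummy that ranges over the one-point set \<open>{0}\<close>.\<close>
  define G where "G = (\<lambda>t (_::real). exp (- 2 * L * t) * ((X t - Y t) \<bullet> (X t - Y t)))"
  define D where "D = (\<lambda>t. exp (- 2 * L * t) * (2 * ((X t - Y t) \<bullet> (F (X t) - F (Y t))) - 2 * L * ((X t - Y t) \<bullet> (X t - Y t))))"
  have der: "((\<lambda>s. G s v) has_real_derivative D t) (at t within {0..})" if "t \<ge> 0" for t v
  proof -
    have "((\<lambda>t. X t - Y t) has_derivative (\<lambda>h. h *\<^sub>R (F (X t) - F (Y t)))) (at t within {0..})"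
      using has_vector_derivative_diff[OF X(2) Y(2)] that by (simp add: has_vector_derivative_def)
    from has_derivative_inner[OF this this]
    have u: "((\<lambda>t. (X t - Y t) \<bullet> (X t - Y t)) has_real_derivative 2 * ((X t - Y t) \<bullet> (F (X t) - F (Y t)))) (at t within {0..})"
      by (rule has_derivative_imp_has_field_derivative) (simp add: inner_commute algebra_simps)
    have "((\<lambda>t. exp (- 2 * L * t)) has_real_derivative exp (- 2 * L * t) * (- 2 * L)) (at t within {0..})"
      by (auto intro!: derivative_eq_intros)
    from DERIV_mult[OF this u] show ?thesis unfolding G_def D_def by (simp add: ring_distribs mult_ac)
  qed
  have "D t \<le> 0" if "t \<ge> 0" for t
  proof -
    have "(X t - Y t) \<bullet> (F (X t) - F (Y t)) \<le> norm (X t - Y t) * norm (F (X t) - F (Y t))"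
      by (rule norm_cauchy_schwarz)
    also have "\<dots> \<le> norm (X t - Y t) * (L * norm (X t - Y t))"
      using lipschitz_onD[OF F X(1)[OF that] Y(1)[OF that]] by (intro mult_left_mono) (auto simp: dist_norm)
    also have "\<dots> = L * ((X t - Y t) \<bullet> (X t - Y t))"
      by (simp add: power2_norm_eq_inner[symmetric] power2_eq_square)
    finally show ?thesis by (simp add: D_def mult_nonneg_nonpos)
  qed
  have "G t 0 \<le> 0"
  proof (rule maximum_principle[where G = G and K = "{0}"])
    have "continuous_on {0..} (\<lambda>t. G t 0)"
      by (rule DERIV_continuous_on[where D = D]) (use der in auto)
    then have "continuous_on ({0..} \<times> {0}) (\<lambda>p. G (fst p) 0)"
      by (rule continuous_on_compose2) (auto intro!: continuous_intros)
    then show "continuous_on ({0..} \<times> {0}) (\<lambda>(t, v). G t v)"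
      by (simp add: case_prod_unfold G_def)
    show "\<exists>D\<le>0. ((\<lambda>s. G s v) has_real_derivative D) (at t within {0..})" if "t > 0" for t v
      using der[of t v] \<open>\<And>t. 0 \<le> t \<Longrightarrow> D t \<le> 0\<close>[of t] that by auto
  qed (use init \<open>0 \<le> t\<close> in \<open>auto simp: G_def\<close>)
  then have "(X t - Y t) \<bullet> (X t - Y t) \<le> 0"
    by (simp add: G_def mult_le_0_iff)
  then show ?thesis by (metis eq_iff_diff_eq_0 inner_eq_zero_iff inner_ge_zero order_antisym)
qed

lemma integral_has_vector_derivative_half_line:
  fixes f :: "real \<Rightarrow> 'a::banach"
  assumes f: "continuous_on {0..} f" and t: "t \<ge> 0"
  shows "((\<lambda>t. integral {0..t} f) has_vector_derivative f t) (at t within {0..})"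
proof -
  have "((\<lambda>t. integral {0..t} f) has_vector_derivative f t) (at t within {0..t + 1})"
    using t by (intro integral_has_vector_derivative continuous_on_subset[OF f]) auto
  moreover have "at t within {0..t + 1} = at t within {0..}"
    by (rule at_within_nhd[of t "{..<t + 1}"]) auto
  ultimately show ?thesis by simp
qed

text \<open>
  Integration of functions of growth \<open>exp (c s)\<close> gains the factor \<open>1 / c\<close> in the correspondingly
  weighted norm, which makes the Picard operator a contraction on the whole half-line at once.
\<close>

lemma weighted_integral_bound:
  fixes f :: "real \<Rightarrow> 'a::banach"
  assumes f: "continuous_on {0..} f" and bound: "\<And>s. s \<ge> 0 \<Longrightarrow> norm (f s) \<le> B * exp (c * s)"
    and c: "c > 0" and B: "B \<ge> 0" and t: "t \<ge> 0"
  shows "norm (exp (- c * t) *\<^sub>R integral {0..t} f) \<le> B / c"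
proof -
  have "((\<lambda>s. B * exp (c * s)) has_integral (B / c * exp (c * t) - B / c * exp (c * 0))) {0..t}"
    using t c by (intro fundamental_theorem_of_calculus)
      (auto intro!: derivative_eq_intros simp: has_real_derivative_iff_has_vector_derivative[symmetric])
  note I = this
  have "norm (integral {0..t} f) \<le> integral {0..t} (\<lambda>s. B * exp (c * s))"
    using bound by (intro integral_norm_bound_integral has_integral_integrable[OF I]
        integrable_continuous_interval continuous_on_subset[OF f]) auto
  also have "\<dots> = B / c * exp (c * t) - B / c * exp (c * 0)"
    using I by (rule integral_unique)
  also have "\<dots> \<le> B / c * exp (c * t)" using B c by simp
  finally have "exp (- c * t) * norm (integral {0..t} f) \<le> exp (- c * t) * (B / c * exp (c * t))"
    by (intro mult_left_mono) auto
  then show ?thesis by (simp add: exp_minus field_simps)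
qed

text \<open>
  A fixed point of the Picard operator is sought in the form \<open>X t = exp (c t) u t\<close> with \<open>u\<close> bounded and
  continuous.  In terms of \<open>u\<close> the operator has the contraction constant \<open>L / c\<close>, so any \<open>c > L\<close>
  yields a global solution by one application of Banach's theorem.
\<close>

theorem lipschitz_ode_global_solution:
  fixes F :: "'a::banach \<Rightarrow> 'a"
  assumes F: "L-lipschitz_on UNIV F"
  obtains X where "X 0 = init" "\<And>t. t \<ge> 0 \<Longrightarrow> (X has_vector_derivative F (X t)) (at t within {0..})"
proof -
  have "L \<ge> 0" using F by (rule lipschitz_on_nonneg)
  \<comment> \<open>Any rate above \<open>L\<close> works; \<open>L + 1\<close> is positive even for \<open>L = 0\<close>.\<close>
  define c where "c = L + 1"
  have "c > 0" using \<open>L \<ge> 0\<close> by (simp add: c_def)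
  define f where "f = (\<lambda>(u :: real \<Rightarrow>\<^sub>C 'a) s. F (exp (c * s) *\<^sub>R apply_bcontfun u s))"
  define J where "J = (\<lambda>u t. integral {0..t} (f u))"
  \<comment> \<open>Bounded continuous functions live on the whole line, so the operator is extended to
      negative times by its value at \<open>0\<close>.\<close>
  define G where "G = (\<lambda>u t. exp (- c * max 0 t) *\<^sub>R (init + J u (max 0 t)))"
  have contf: "continuous_on {0..} (f u)" for u
    unfolding f_def
    by (rule continuous_on_compose2[OF lipschitz_on_continuous_on[OF F]]) (auto intro!: continuous_intros)
  have derJ: "(J u has_vector_derivative f u t) (at t within {0..})" if "t \<ge> 0" for u t
    unfolding J_def by (rule integral_has_vector_derivative_half_line[OF contf that])
  have "continuous_on {0..} (J u)" for u
    by (rule continuous_on_vector_derivative[of _ _ "f u"]) (simp add: derJ)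
  then have contJ: "continuous_on UNIV (\<lambda>t. J u (max 0 t))" for u
    by (rule continuous_on_compose2) (auto intro!: continuous_intros)
  then have contG: "continuous_on UNIV (G u)" for u
    unfolding G_def by (intro continuous_intros)
  have f_bound: "norm (f u s) \<le> (norm (F 0) + L * norm u) * exp (c * s)" if "s \<ge> 0" for u s
  proof -
    have "norm (f u s) \<le> norm (F 0) + norm (f u s - F 0)" by (rule norm_triangle_sub)
    also have "norm (f u s - F 0) \<le> L * norm (exp (c * s) *\<^sub>R apply_bcontfun u s)"
      using lipschitz_onD[OF F, of "exp (c * s) *\<^sub>R apply_bcontfun u s" 0] by (simp add: f_def dist_norm)
    also have "\<dots> \<le> L * (exp (c * s) * norm u)"
      using \<open>L \<ge> 0\<close> by (auto intro!: mult_left_mono norm_bounded)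
    also have "norm (F 0) + L * (exp (c * s) * norm u) \<le> norm (F 0) * exp (c * s) + L * (exp (c * s) * norm u)"
      using that \<open>c > 0\<close> mult_left_mono[of 1 "exp (c * s)" "norm (F 0)"] by simp
    finally show ?thesis by (simp add: algebra_simps)
  qed
  have "norm (G u t) \<le> norm init + (norm (F 0) + L * norm u) / c" for u t
  proof -
    let ?\<tau> = "max 0 t"
    have "norm (exp (- c * ?\<tau>) *\<^sub>R init) \<le> norm init"
      using \<open>c > 0\<close> by (simp add: mult_left_le_one_le)
    moreover have "norm (exp (- c * ?\<tau>) *\<^sub>R J u ?\<tau>) \<le> (norm (F 0) + L * norm u) / c"
      unfolding J_def using \<open>c > 0\<close> \<open>L \<ge> 0\<close> by (intro weighted_integral_bound contf f_bound) auto
    ultimately show ?thesis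
      unfolding G_def scaleR_add_right by (intro norm_triangle_mono)
  qed
  then have G_bcontfun: "G u \<in> bcontfun" for u
    by (intro bcontfun_normI contG)
  define \<Phi> where "\<Phi> = (\<lambda>u. Bcontfun (G u))"
  have \<Phi>: "apply_bcontfun (\<Phi> u) = G u" for u
    by (simp add: \<Phi>_def Bcontfun_inverse G_bcontfun)
  have "dist (\<Phi> u) (\<Phi> v) \<le> L / c * dist u v" for u v
  proof (rule dist_bound)
    fix t :: real
    let ?\<tau> = "max 0 t"
    have int: "f w integrable_on {0..?\<tau>}" for w
      by (intro integrable_continuous_interval continuous_on_subset[OF contf]) auto
    have "norm (f u s - f v s) \<le> (L * dist u v) * exp (c * s)" for s
    proof -
      have "norm (f u s - f v s) \<le> L * norm (exp (c * s) *\<^sub>R (apply_bcontfun u s - apply_bcontfun v s))"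
        using lipschitz_onD[OF F, of "exp (c * s) *\<^sub>R apply_bcontfun u s" "exp (c * s) *\<^sub>R apply_bcontfun v s"]
        by (simp add: f_def dist_norm scaleR_diff_right)
      also have "\<dots> = L * (exp (c * s) * dist (apply_bcontfun u s) (apply_bcontfun v s))"
        by (simp add: dist_norm)
      also have "\<dots> \<le> L * (exp (c * s) * dist u v)"
        using \<open>L \<ge> 0\<close> by (intro mult_left_mono dist_bounded) auto
      finally show ?thesis by (simp add: algebra_simps)
    qed
    then have "norm (exp (- c * ?\<tau>) *\<^sub>R integral {0..?\<tau>} (\<lambda>s. f u s - f v s)) \<le> (L * dist u v) / c"
      using \<open>c > 0\<close> \<open>L \<ge> 0\<close> by (intro weighted_integral_bound continuous_intros contf) auto
    then show "dist (apply_bcontfun (\<Phi> u) t) (apply_bcontfun (\<Phi> v) t) \<le> L / c * dist u v"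
      by (simp add: \<Phi> G_def dist_norm J_def int integral_diff flip: scaleR_diff_right)
  qed
  moreover have "0 \<le> L / c" "L / c < 1" using \<open>L \<ge> 0\<close> by (auto simp: c_def)
  ultimately obtain u where u: "\<Phi> u = u"
    using banach_fix_type[of "L / c" \<Phi>] by blast
  define X where "X = (\<lambda>t. exp (c * t) *\<^sub>R apply_bcontfun u t)"
  have X: "X t = init + J u t" if "t \<ge> 0" for t
  proof -
    have "apply_bcontfun u t = G u t" by (metis \<Phi> u)
    then show ?thesis using that by (simp add: X_def G_def exp_minus)
  qed
  show thesis
  proof
    show "X 0 = init" using X[of 0] by (simp add: J_def)
    fix t :: real assume t: "t \<ge> 0"
    have "((\<lambda>t. init + J u t) has_vector_derivative F (X t)) (at t within {0..})"
      using derJ[OF t, of u] by (simp add: f_def X_def has_vector_derivative_add_const[of "J u", simplified add.commute])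
    then show "(X has_vector_derivative F (X t)) (at t within {0..})"
      by (rule has_vector_derivative_transform[rotated -1]) (use t X in auto)
  qed
qed

section \<open>Singular values along the flow\<close>

lemma herm_fun_uminus:
  assumes "mat_adj A = A"
  shows "herm_fun (\<lambda>x. - f x) A = - herm_fun f A"
proof -
  obtain U d where U: "unitary_mat U" "A = U ** real_diag d ** mat_adj U"
    using hermitian_diagonalization[OF assms] by blast
  have "real_diag ((\<lambda>x. - f x) \<circ> d) = - real_diag (f \<circ> d)"
    by (simp add: real_diag_def vec_eq_iff)
  then show ?thesis
    by (simp add: herm_fun_eq[OF U] cmat_mult.minus_left cmat_mult.minus_right)
qed

lemma phi_mat_uminus: "phi_mat (\<lambda>x. - f x) (\<lambda>x. - g x) X = - phi_mat f g X"
  by (simp add: phi_mat_def herm_fun_uminus)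

lemma mat_interval_iff_unit:
  assumes "0 \<le> a"
  shows "X \<in> mat_interval a b \<longleftrightarrow> (\<forall>v. norm v = 1 \<longrightarrow> a \<le> norm (X *v v) \<and> norm (X *v v) \<le> b)"
  unfolding mat_interval_iff[OF assms]
proof (intro iffI allI impI)
  fix v assume *: "\<forall>v. norm v = 1 \<longrightarrow> a \<le> norm (X *v v) \<and> norm (X *v v) \<le> b"
  show "a * norm v \<le> norm (X *v v) \<and> norm (X *v v) \<le> b * norm v"
  proof (cases "v = 0")
    case False
    then have "norm ((1 / norm v) *\<^sub>R v) = 1" by simp
    with * have "a \<le> norm (X *v ((1 / norm v) *\<^sub>R v))" "norm (X *v ((1 / norm v) *\<^sub>R v)) \<le> b" by blast+
    then show ?thesis using False by (simp add: cmat_vec.scaleR_right field_simps)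
  qed simp
next
  fix v :: "complex ^ 'a"
  assume *: "\<forall>v. a * norm v \<le> norm (X *v v) \<and> norm (X *v v) \<le> b * norm v" and "norm v = 1"
  then show "a \<le> norm (X *v v) \<and> norm (X *v v) \<le> b" using *[rule_format, of v] by simp
qed

text \<open>
  Both extremes are handled by the maximizer lemma, applied to \<open>Y* Y\<close> for a maximum and to its
  negative for a minimum.
\<close>

lemma eigenvector_of_extremal_stretch:
  fixes Y :: "('n::finite) cmat"
  assumes v: "norm v = 1"
    and ext: "(\<forall>w. norm w = 1 \<longrightarrow> norm (Y *v w) \<le> norm (Y *v v)) \<or> (\<forall>w. norm w = 1 \<longrightarrow> norm (Y *v v) \<le> norm (Y *v w))"
  shows "(mat_adj Y ** Y) *v v = (norm (Y *v v))\<^sup>2 *\<^sub>R v"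
proof -
  let ?A = "mat_adj Y ** Y" and ?m = "norm (Y *v v)"
  have herm: "mat_adj ?A = ?A" by (simp add: mat_adj_mult)
  have scale: "w = norm w *\<^sub>R ((1 / norm w) *\<^sub>R w)" "norm ((1 / norm w) *\<^sub>R w) = 1" if "w \<noteq> 0" for w :: "complex ^ 'n"
    using that by auto
  have q: "w \<bullet> (?A *v w) = (norm (Y *v w))\<^sup>2" for w by (simp only: norm_mult_sq)
  from ext show ?thesis
  proof
    assume max: "\<forall>w. norm w = 1 \<longrightarrow> norm (Y *v w) \<le> ?m"
    then have "Y \<in> mat_interval 0 ?m" by (simp add: mat_interval_iff_unit)
    then have "(norm (Y *v w))\<^sup>2 \<le> (?m * norm w)\<^sup>2" for w
      by (intro power_mono) (auto simp: mat_interval_iff)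
    then show ?thesis
      using v by (intro maximizer_eigenvector[OF herm subspace_UNIV])
        (auto simp: q power_mult_distrib simp flip: power2_norm_eq_inner)
  next
    assume min: "\<forall>w. norm w = 1 \<longrightarrow> ?m \<le> norm (Y *v w)"
    have "?m * norm w \<le> norm (Y *v w)" for w
    proof (cases "w = 0")
      case False
      with min have "?m \<le> norm (Y *v ((1 / norm w) *\<^sub>R w))" by simp
      then show ?thesis using False by (simp add: cmat_vec.scaleR_right field_simps)
    qed simp
    then have "(?m * norm w)\<^sup>2 \<le> (norm (Y *v w))\<^sup>2" for w
      by (intro power_mono) auto
    moreover have "mat_adj (- ?A) = - ?A"
      using herm by (simp add: mat_adj_def vec_eq_iff)
    ultimately have "(- ?A) *v v = (- ?m\<^sup>2) *\<^sub>R v"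
      using v by (intro maximizer_eigenvector[OF _ subspace_UNIV])
        (auto simp: q power_mult_distrib cmat_vec.minus_left simp flip: power2_norm_eq_inner)
    then show ?thesis by (simp add: cmat_vec.minus_left)
  qed
qed

text \<open>
  At a top right singular vector the value \<open>s\<close> is the right end of the interval of all singular
  values, where increasing functions are largest.
\<close>

lemma top_singular_value_decreases:
  fixes Y :: "('n::finite) cmat"
  assumes f: "mono f1" "mono f2" and v: "norm v = 1"
    and max: "\<And>w. norm w = 1 \<Longrightarrow> norm (Y *v w) \<le> norm (Y *v v)"
  shows "(Y *v v) \<bullet> (commutator (phi_mat f1 f2 Y) Y *v v) \<le> 0"
proof (rule singular_vector_derivative_nonpos)
  show "Y \<in> mat_interval 0 (norm (Y *v v))" using max by (simp add: mat_interval_iff_unit)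
  show "(mat_adj Y ** Y) *v v = (norm (Y *v v))\<^sup>2 *\<^sub>R v"
    using v max by (intro eigenvector_of_extremal_stretch) auto
qed (use f in \<open>auto dest: monoD\<close>)

text \<open>
  At a bottom right singular vector \<open>s\<close> is the left end of the interval, where the decreasing
  functions \<open>- f1\<close> and \<open>- f2\<close> are largest; they generate the field with the opposite sign.
\<close>

lemma bottom_singular_value_increases:
  fixes Y :: "('n::finite) cmat"
  assumes f: "mono f1" "mono f2" and v: "norm v = 1"
    and min: "\<And>w. norm w = 1 \<Longrightarrow> norm (Y *v v) \<le> norm (Y *v w)"
  shows "(Y *v v) \<bullet> (commutator (phi_mat f1 f2 Y) Y *v v) \<ge> 0"
proof -
  obtain B where B: "\<And>w. norm (Y *v w) \<le> norm w * B"
    using cmat_vec.bounded_linear_right[THEN bounded_linear.bounded] by blast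
  have "(Y *v v) \<bullet> (commutator (phi_mat (\<lambda>x. - f1 x) (\<lambda>x. - f2 x) Y) Y *v v) \<le> 0"
  proof (rule singular_vector_derivative_nonpos)
    show "Y \<in> mat_interval (norm (Y *v v)) B" using min B
      by (simp add: mat_interval_iff_unit) (metis mult_1)
    show "(mat_adj Y ** Y) *v v = (norm (Y *v v))\<^sup>2 *\<^sub>R v"
      using v min by (intro eigenvector_of_extremal_stretch) auto
  qed (use f in \<open>auto dest: monoD\<close>)
  moreover have "commutator (- M) Y = - commutator M Y" for M
    by (simp add: commutator_def cmat_mult.minus_left cmat_mult.minus_right)
  ultimately show ?thesis by (simp add: phi_mat_uminus cmat_vec.minus_left)
qed

text \<open>
  Truncating the vector field by the projection onto a ball only rescales the matrix at which the
  field is evaluated, and so keeps its singular vectors and their extremality.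
\<close>

lemma closest_point_cball_scaleR:
  fixes x :: "'a::euclidean_space"
  assumes "R > 0"
  obtains c where "c > 0" "closest_point (cball 0 R) x = c *\<^sub>R x"
proof (cases "norm x \<le> R")
  case True
  then show ?thesis using that[of 1] by (simp add: closest_point_self)
next
  case False
  then have "norm x > R" "norm x > 0" using assms by auto
  have "(R / norm x) *\<^sub>R x = closest_point (cball 0 R) x"
  proof (rule closest_point_unique)
    show "\<forall>z\<in>cball 0 R. dist x ((R / norm x) *\<^sub>R x) \<le> dist x z"
    proof
      fix z assume "z \<in> cball (0::'a) R"
      have "x - (R / norm x) *\<^sub>R x = (1 - R / norm x) *\<^sub>R x" by (simp add: algebra_simps)
      then have "dist x ((R / norm x) *\<^sub>R x) = \<bar>1 - R / norm x\<bar> * norm x" by (simp add: dist_norm)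
      also have "\<dots> = norm x - R" using \<open>norm x > R\<close> \<open>norm x > 0\<close> by (simp add: abs_if field_simps)
      also have "\<dots> \<le> norm x - norm z" using \<open>z \<in> cball 0 R\<close> by simp
      also have "\<dots> \<le> dist x z" by (simp add: dist_norm norm_triangle_ineq2)
      finally show "dist x ((R / norm x) *\<^sub>R x) \<le> dist x z" .
    qed
  qed (use assms in auto)
  then show ?thesis using that[of "R / norm x"] assms \<open>norm x > 0\<close> by simp
qed

lemma phi_mat_lipschitz:
  assumes f1: "L1-lipschitz_on UNIV f1" and f2: "L2-lipschitz_on UNIV f2"
  shows "((L1 + L2) * sqrt 2)-lipschitz_on UNIV (phi_mat f1 f2)"
proof (rule lipschitz_onI)
  have L: "0 \<le> L1" "0 \<le> L2" using f1 f2 by (auto dest: lipschitz_on_nonneg)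
  then show "0 \<le> (L1 + L2) * sqrt 2" by simp
  fix X Y :: "'a cmat"
  have 1: "norm (herm_fun f1 (mat_abs X) - herm_fun f1 (mat_abs Y)) \<le> L1 * (sqrt 2 * norm (X - Y))"
    by (rule order_trans[OF herm_fun_lipschitz[OF _ _ f1] mult_left_mono[OF mat_abs_lipschitz]]) (use L in auto)
  have "norm (herm_fun f2 (mat_abs (mat_adj X)) - herm_fun f2 (mat_abs (mat_adj Y)))
      \<le> L2 * (sqrt 2 * norm (mat_adj X - mat_adj Y))"
    by (rule order_trans[OF herm_fun_lipschitz[OF _ _ f2] mult_left_mono[OF mat_abs_lipschitz]]) (use L in auto)
  also have "norm (mat_adj X - mat_adj Y) = norm (X - Y)"
    by (simp only: norm_mat_adj flip: mat_adj_diff)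
  finally have 2: "norm (herm_fun f2 (mat_abs (mat_adj X)) - herm_fun f2 (mat_abs (mat_adj Y))) \<le> L2 * (sqrt 2 * norm (X - Y))" .
  have "norm (phi_mat f1 f2 X - phi_mat f1 f2 Y)
     = norm ((herm_fun f1 (mat_abs X) - herm_fun f1 (mat_abs Y)) - (herm_fun f2 (mat_abs (mat_adj X)) - herm_fun f2 (mat_abs (mat_adj Y))))"
    by (simp add: phi_mat_def algebra_simps)
  also have "\<dots> \<le> L1 * (sqrt 2 * norm (X - Y)) + L2 * (sqrt 2 * norm (X - Y))"
    by (intro norm_triangle_le_diff add_mono 1 2)
  finally show "dist (phi_mat f1 f2 X) (phi_mat f1 f2 Y) \<le> (L1 + L2) * sqrt 2 * dist X Y"
    by (simp add: dist_norm algebra_simps)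
qed

text \<open>
  A product of Lipschitz factors is Lipschitz on bounded sets only; this is why the field has to be
  truncated before the global existence theorem applies.
\<close>

lemma commutator_field_lipschitz:
  fixes h :: "('n::finite) cmat \<Rightarrow> 'n cmat"
  assumes h: "C-lipschitz_on UNIV h" and "R \<ge> 0"
  obtains M where "M-lipschitz_on (cball 0 R) (\<lambda>X. commutator (h X) X)"
proof -
  obtain K where K: "K > 0" "\<And>(A :: 'n cmat) (B :: 'n cmat). norm (A ** B) \<le> norm A * norm B * K"
    using cmat_mult.pos_bounded by metis
  have "C \<ge> 0" using h by (rule lipschitz_on_nonneg)
  define H where "H = norm (h 0) + C * R"
  have "H \<ge> 0" using \<open>C \<ge> 0\<close> \<open>R \<ge> 0\<close> by (simp add: H_def)
  have "(2 * K * (H + C * R))-lipschitz_on (cball 0 R) (\<lambda>X. commutator (h X) X)"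
  proof (rule lipschitz_onI)
    show "0 \<le> 2 * K * (H + C * R)" using K(1) \<open>H \<ge> 0\<close> \<open>C \<ge> 0\<close> \<open>R \<ge> 0\<close> by simp
    fix X Y :: "'n cmat" assume "X \<in> cball 0 R" "Y \<in> cball 0 R"
    then have "norm X \<le> R" "norm Y \<le> R" by auto
    let ?d = "norm (X - Y)"
    have hd: "norm (h X - h Y) \<le> C * ?d"
      using lipschitz_onD[OF h, of X Y] by (simp add: dist_norm)
    have "norm (h X) \<le> norm (h 0) + norm (h X - h 0)" by (rule norm_triangle_sub)
    also have "norm (h X - h 0) \<le> C * norm X"
      using lipschitz_onD[OF h, of X 0] by (simp add: dist_norm)
    also have "\<dots> \<le> C * R" using \<open>C \<ge> 0\<close> \<open>norm X \<le> R\<close> by (rule mult_left_mono[rotated])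
    finally have hX: "norm (h X) \<le> H" by (simp add: H_def)
    have bound: "norm (A ** B) \<le> p * q * K" "norm (B ** A) \<le> p * q * K" if "norm A \<le> p" "norm B \<le> q" for A B :: "'n cmat" and p q
    proof -
      have "norm A * norm B * K \<le> p * q * K"
        using that K(1) order_trans[OF norm_ge_zero that(1)] by (intro mult_right_mono mult_mono) auto
      then show "norm (A ** B) \<le> p * q * K" "norm (B ** A) \<le> p * q * K"
        using K(2)[of A B] K(2)[of B A] by (simp_all add: mult.commute[of "norm B"])
    qed
    have "commutator (h X) X - commutator (h Y) Y
       = (h X ** (X - Y) - (X - Y) ** h X) + ((h X - h Y) ** Y - Y ** (h X - h Y))"
      unfolding commutator_def cmat_mult.diff_left cmat_mult.diff_right by simp
    then have "norm (commutator (h X) X - commutator (h Y) Y)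
       \<le> (norm (h X ** (X - Y)) + norm ((X - Y) ** h X)) + (norm ((h X - h Y) ** Y) + norm (Y ** (h X - h Y)))"
      by (simp only:) (intro norm_triangle_mono norm_triangle_ineq4)
    also have "\<dots> \<le> (H * ?d * K + H * ?d * K) + (C * ?d * R * K + C * ?d * R * K)"
      by (rule add_mono[OF add_mono[OF bound[OF hX order.refl]] add_mono[OF bound[OF hd \<open>norm Y \<le> R\<close>]]])
    finally have "norm (commutator (h X) X - commutator (h Y) Y)
       \<le> (H * ?d * K + H * ?d * K) + (C * ?d * R * K + C * ?d * R * K)" .
    then show "dist (commutator (h X) X) (commutator (h Y) Y) \<le> 2 * K * (H + C * R) * dist X Y"
      by (simp add: dist_norm ring_distribs mult_ac)
  qed
  then show ?thesis by (rule that)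
qed

lemma norm_le_of_mat_interval:
  fixes X :: "('n::finite) cmat" and b :: real
  assumes "0 \<le> a" "X \<in> mat_interval a b"
  shows "norm X \<le> sqrt (CARD('n) * b\<^sup>2)"
proof (rule real_le_rsqrt)
  have "(X *v axis j 1) $ i = X $ i $ j" for i j
    by (simp add: matrix_vector_mult_def axis_def if_distrib cong: if_cong)
  then have "(norm X)\<^sup>2 = (\<Sum>i\<in>UNIV. \<Sum>j\<in>UNIV. (cmod ((X *v axis j 1) $ i))\<^sup>2)"
    by (simp add: norm_matrix_sq)
  also have "\<dots> = (\<Sum>j\<in>UNIV. \<Sum>i\<in>UNIV. (cmod ((X *v axis j 1) $ i))\<^sup>2)"
    by (rule sum.swap)
  also have "\<dots> = (\<Sum>j\<in>UNIV. (norm (X *v axis j 1))\<^sup>2)"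
    by (simp only: norm_vec_sq)
  also have "\<dots> \<le> (\<Sum>j\<in>(UNIV::'n set). b\<^sup>2)"
    using assms by (intro sum_mono power_mono) (auto simp: mat_interval_iff_unit norm_axis_1)
  finally show "(norm X)\<^sup>2 \<le> CARD('n) * b\<^sup>2" by simp
qed

text \<open>
  The maximum principle is applied over the unit sphere to the squared length of \<open>X t v\<close> and to its
  negative.  Maximizers are then top, respectively bottom, singular vectors of \<open>X t\<close>.  They have the
  same property for the positive multiple of \<open>X t\<close> at which the truncated field evaluates the
  commutator, and there the sign of the derivative is known.
\<close>

lemma singular_value_interval_invariant:
  fixes X :: "real \<Rightarrow> ('n::finite) cmat"
  assumes a: "0 \<le> a" and "0 \<le> b" and f: "mono f1" "mono f2" and R: "R > 0"
    and X: "\<And>t. t \<ge> 0 \<Longrightarrow> (X has_vector_derivative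
      (let Z = closest_point (cball 0 R) (X t) in commutator (phi_mat f1 f2 Z) Z)) (at t within {0..})"
    and X0: "X 0 \<in> mat_interval a b" and t: "t \<ge> 0"
  shows "X t \<in> mat_interval a b"
proof -
  define F where "F = (\<lambda>Y :: 'n cmat. let Z = closest_point (cball 0 R) Y in commutator (phi_mat f1 f2 Z) Z)"
  let ?K = "sphere 0 1 :: (complex ^ 'n) set"
  have contX: "continuous_on {0..} X"
    by (rule continuous_on_vector_derivative[of _ _ "\<lambda>t. F (X t)"]) (use X in \<open>auto simp: F_def\<close>)
  have cont: "continuous_on ({0..} \<times> ?K) (\<lambda>p. (norm (X (fst p) *v snd p))\<^sup>2)"
    by (intro continuous_intros cmat_vec.continuous_on continuous_on_compose2[OF contX]) auto
  have der: "((\<lambda>s. (norm (X s *v v))\<^sup>2) has_real_derivative 2 * ((X t *v v) \<bullet> (F (X t) *v v))) (at t within {0..})"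
    if "t \<ge> 0" for t v
  proof -
    have "((\<lambda>s. X s *v v) has_vector_derivative F (X t) *v v) (at t within {0..})"
      using X[OF that] unfolding F_def by (rule bounded_linear.has_vector_derivative[OF cmat_vec.bounded_linear_left])
    then have "((\<lambda>s. X s *v v) has_derivative (\<lambda>h. h *\<^sub>R (F (X t) *v v))) (at t within {0..})"
      by (simp add: has_vector_derivative_def)
    from has_derivative_inner[OF this this] show ?thesis
      unfolding power2_norm_eq_inner
      by (rule has_derivative_imp_has_field_derivative) (simp add: inner_commute algebra_simps)
  qed
  have scaled: "\<exists>c>0. \<exists>Z. Z = c *\<^sub>R Y \<and> F Y = commutator (phi_mat f1 f2 Z) Z" for Y
    using closest_point_cball_scaleR[OF R, of Y] unfolding F_def Let_def by metis
  have top: "(Y *v v) \<bullet> (F Y *v v) \<le> 0"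
    if v: "norm v = 1" and max: "\<And>w. norm w = 1 \<Longrightarrow> norm (Y *v w) \<le> norm (Y *v v)" for Y v
  proof -
    obtain c Z where c: "c > 0" and Z: "Z = c *\<^sub>R Y" "F Y = commutator (phi_mat f1 f2 Z) Z"
      using scaled[of Y] by blast
    have "(Z *v v) \<bullet> (F Y *v v) \<le> 0"
      unfolding Z(2) using max c
      by (intro top_singular_value_decreases[OF f v]) (simp add: Z(1) cmat_vec.scaleR_left)
    then show ?thesis using c by (simp add: Z(1) cmat_vec.scaleR_left mult_le_0_iff)
  qed
  have bottom: "(Y *v v) \<bullet> (F Y *v v) \<ge> 0"
    if v: "norm v = 1" and min: "\<And>w. norm w = 1 \<Longrightarrow> norm (Y *v v) \<le> norm (Y *v w)" for Y v
  proof -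
    obtain c Z where c: "c > 0" and Z: "Z = c *\<^sub>R Y" "F Y = commutator (phi_mat f1 f2 Z) Z"
      using scaled[of Y] by blast
    have "(Z *v v) \<bullet> (F Y *v v) \<ge> 0"
      unfolding Z(2) using min c
      by (intro bottom_singular_value_increases[OF f v]) (simp add: Z(1) cmat_vec.scaleR_left)
    then show ?thesis using c by (simp add: Z(1) cmat_vec.scaleR_left zero_le_mult_iff)
  qed
  have X0': "a \<le> norm (X 0 *v w)" "norm (X 0 *v w) \<le> b" if "norm w = 1" for w
    using X0 that by (auto simp: mat_interval_iff_unit[OF a])
  have upper: "(norm (X t *v w))\<^sup>2 \<le> b\<^sup>2" if "norm w = 1" for w
  proof (rule maximum_principle[where G = "\<lambda>t v. (norm (X t *v v))\<^sup>2" and K = ?K])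
    show "continuous_on ({0..} \<times> ?K) (\<lambda>(t, v). (norm (X t *v v))\<^sup>2)"
      using cont by (simp add: case_prod_unfold)
    fix t v assume "0 < t" "v \<in> ?K" and max: "\<And>w. w \<in> ?K \<Longrightarrow> (norm (X t *v w))\<^sup>2 \<le> (norm (X t *v v))\<^sup>2"
    then have "(X t *v v) \<bullet> (F (X t) *v v) \<le> 0"
      by (intro top) (auto intro: power2_le_imp_le)
    then show "\<exists>D\<le>0. ((\<lambda>s. (norm (X s *v v))\<^sup>2) has_real_derivative D) (at t within {0..})"
      using der[of t v] \<open>0 < t\<close> by (intro exI conjI) auto
  qed (use t that X0' in \<open>auto intro!: power_mono\<close>)
  have lower: "- (norm (X t *v w))\<^sup>2 \<le> - a\<^sup>2" if "norm w = 1" for w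
  proof (rule maximum_principle[where G = "\<lambda>t v. - (norm (X t *v v))\<^sup>2" and K = ?K])
    show "continuous_on ({0..} \<times> ?K) (\<lambda>(t, v). - (norm (X t *v v))\<^sup>2)"
      using continuous_on_minus[OF cont] by (simp add: case_prod_unfold)
    fix t v assume "0 < t" "v \<in> ?K" and max: "\<And>w. w \<in> ?K \<Longrightarrow> - (norm (X t *v w))\<^sup>2 \<le> - (norm (X t *v v))\<^sup>2"
    then have "(X t *v v) \<bullet> (F (X t) *v v) \<ge> 0"
      by (intro bottom) (auto intro: power2_le_imp_le)
    then show "\<exists>D\<le>0. ((\<lambda>s. - (norm (X s *v v))\<^sup>2) has_real_derivative D) (at t within {0..})"
      using DERIV_minus[OF der[of t v]] \<open>0 < t\<close> by (intro exI conjI) auto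
  qed (use t that X0' a in \<open>auto intro!: power_mono\<close>)
  show ?thesis
    unfolding mat_interval_iff_unit[OF a]
    using upper lower \<open>0 \<le> b\<close> by (auto intro: power2_le_imp_le)
qed

section \<open>Existence and uniqueness\<close>

text \<open>
  Evaluating at the nearest point of \<open>[a, b]\<close> extends a function to the whole line without losing
  monotonicity or the Lipschitz constant.
\<close>

lemma clamped_lipschitz:
  fixes g :: "real \<Rightarrow> real"
  assumes "a \<le> b" and g: "L-lipschitz_on {a..b} g"
  shows "L-lipschitz_on UNIV (\<lambda>x. g (max a (min b x)))"
proof (rule lipschitz_onI)
  fix x y :: real
  have "dist (g (max a (min b x))) (g (max a (min b y))) \<le> L * dist (max a (min b x)) (max a (min b y))"
    using \<open>a \<le> b\<close> by (intro lipschitz_onD[OF g]) auto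
  also have "\<dots> \<le> L * dist x y"
    using lipschitz_on_nonneg[OF g] by (intro mult_left_mono) (auto simp: dist_real_def)
  finally show "dist (g (max a (min b x))) (g (max a (min b y))) \<le> L * dist x y" .
qed (rule lipschitz_on_nonneg[OF g])

lemma clamped_mono:
  fixes g :: "real \<Rightarrow> real"
  assumes "a \<le> b" and g: "mono_on {a..b} g"
  shows "mono (\<lambda>x. g (max a (min b x)))"
  using \<open>a \<le> b\<close> by (intro monoI mono_onD[OF g]) auto

theorem theorem2p7:
  fixes a b :: real and \<phi>1 \<phi>2 :: "real \<Rightarrow> real" and T :: "('n::finite) cmat"
  assumes "0 \<le> a" and "a \<le> b"
    and "\<exists>L. L-lipschitz_on {a..b} \<phi>1" and "\<exists>L. L-lipschitz_on {a..b} \<phi>2"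
    and "mono_on {a..b} \<phi>1" and "mono_on {a..b} \<phi>2"
    and "strict_mono_on {a..b} (\<lambda>x. \<phi>1 x + \<phi>2 x)"
    and "T \<in> mat_interval a b"
  shows "\<exists>!X. X \<in> {0..} \<rightarrow>\<^sub>E mat_interval a b \<and> X 0 = T \<and>
    (\<forall>t\<ge>0. (X has_vector_derivative commutator (phi_mat \<phi>1 \<phi>2 (X t)) (X t)) (at t within {0..}))"
proof -
  let ?M = "mat_interval a b :: 'n cmat set"
  obtain L1 L2 where L1: "L1-lipschitz_on {a..b} \<phi>1" and L2: "L2-lipschitz_on {a..b} \<phi>2"
    using assms(3,4) by blast
  \<comment> \<open>Extended functions are needed because the solution is first constructed without
      knowing that its singular values stay in \<open>[a, b]\<close>.\<close>
  define f1 where "f1 = (\<lambda>x. \<phi>1 (max a (min b x)))"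
  define f2 where "f2 = (\<lambda>x. \<phi>2 (max a (min b x)))"
  have lip: "L1-lipschitz_on UNIV f1" "L2-lipschitz_on UNIV f2"
    unfolding f1_def f2_def by (rule clamped_lipschitz[OF assms(2)], fact)+
  have mono: "mono f1" "mono f2"
    unfolding f1_def f2_def by (rule clamped_mono[OF assms(2)], fact)+
  have ext: "\<phi>1 x = f1 x" "\<phi>2 x = f2 x" if "x \<in> {a..b}" for x
    using that by (simp_all add: f1_def f2_def)
  define E where "E = (\<lambda>Y :: 'n cmat. commutator (phi_mat f1 f2 Y) Y)"
  have E: "commutator (phi_mat \<phi>1 \<phi>2 Y) Y = E Y" if "Y \<in> ?M" for Y
    using herm_fun_mat_abs_cong[of Y a b \<phi>1 f1, OF that ext(1)]
      herm_fun_mat_abs_cong[of "mat_adj Y" a b \<phi>2 f2, OF mat_interval_adj[OF assms(1) that] ext(2)]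
    by (simp add: E_def phi_mat_def)
  \<comment> \<open>The root bounds the norm on \<open>?M\<close>; adding \<open>1\<close> keeps the radius positive when \<open>b = 0\<close>.\<close>
  define R where "R = sqrt (CARD('n) * b\<^sup>2) + 1"
  have "R > 0" by (simp add: R_def add_nonneg_pos)
  have M_R: "?M \<subseteq> cball 0 R"
  proof
    fix Y assume "Y \<in> ?M"
    from norm_le_of_mat_interval[OF assms(1) this] show "Y \<in> cball 0 R" by (simp add: R_def)
  qed
  obtain C where C: "C-lipschitz_on (cball 0 R) E"
    unfolding E_def
    by (rule commutator_field_lipschitz[OF phi_mat_lipschitz[OF lip] less_imp_le[OF \<open>R > 0\<close>]])
  define F where "F = (\<lambda>Y. E (closest_point (cball 0 R) Y))"
  have "C-lipschitz_on UNIV F"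
  proof (rule lipschitz_onI)
    fix Y Z :: "'n cmat"
    have "closest_point (cball 0 R) W \<in> cball 0 R" for W :: "'n cmat"
      using \<open>R > 0\<close> by (intro closest_point_in_set) auto
    then have "dist (F Y) (F Z) \<le> C * dist (closest_point (cball 0 R) Y) (closest_point (cball 0 R) Z)"
      unfolding F_def by (intro lipschitz_onD[OF C])
    also have "\<dots> \<le> C * dist Y Z"
      using \<open>R > 0\<close> lipschitz_on_nonneg[OF C] by (intro mult_left_mono closest_point_lipschitz) auto
    finally show "dist (F Y) (F Z) \<le> C * dist Y Z" .
  qed (rule lipschitz_on_nonneg[OF C])
  then obtain X where X: "X 0 = T" "\<And>t. t \<ge> 0 \<Longrightarrow> (X has_vector_derivative F (X t)) (at t within {0..})"
    by (rule lipschitz_ode_global_solution[where init = T]) (rule that)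
  have XM: "X t \<in> ?M" if "t \<ge> 0" for t
  proof (rule singular_value_interval_invariant[OF assms(1) _ mono \<open>R > 0\<close> _ _ that])
    show "0 \<le> b" using assms(1,2) by simp
    show "X 0 \<in> ?M" using X(1) assms(8) by simp
    show "(X has_vector_derivative (let Z = closest_point (cball 0 R) (X t) in commutator (phi_mat f1 f2 Z) Z))
        (at t within {0..})" if "t \<ge> 0" for t
      using X(2)[OF that] by (simp add: F_def E_def Let_def)
  qed
  have FX: "F (X t) = commutator (phi_mat \<phi>1 \<phi>2 (X t)) (X t)" if "t \<ge> 0" for t
    using XM[OF that] M_R by (simp add: F_def E closest_point_self subset_iff)
  show ?thesis
  proof (rule ex_ex1I)
    let ?X = "restrict X {0..}"
    have "(?X has_vector_derivative commutator (phi_mat \<phi>1 \<phi>2 (?X t)) (?X t)) (at t within {0..})"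
      if "t \<ge> 0" for t
    proof (rule has_vector_derivative_transform)
      show "(X has_vector_derivative commutator (phi_mat \<phi>1 \<phi>2 (?X t)) (?X t)) (at t within {0..})"
        using X(2)[OF that] that by (simp add: FX)
    qed (use that in auto)
    then show "\<exists>X. X \<in> {0..} \<rightarrow>\<^sub>E ?M \<and> X 0 = T \<and>
        (\<forall>t\<ge>0. (X has_vector_derivative commutator (phi_mat \<phi>1 \<phi>2 (X t)) (X t)) (at t within {0..}))"
      using XM X(1) by (intro exI[of _ ?X] conjI allI impI) simp_all
  next
    fix X Y
    assume X: "X \<in> {0..} \<rightarrow>\<^sub>E ?M \<and> X 0 = T \<and>
        (\<forall>t\<ge>0. (X has_vector_derivative commutator (phi_mat \<phi>1 \<phi>2 (X t)) (X t)) (at t within {0..}))"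
      and Y: "Y \<in> {0..} \<rightarrow>\<^sub>E ?M \<and> Y 0 = T \<and>
        (\<forall>t\<ge>0. (Y has_vector_derivative commutator (phi_mat \<phi>1 \<phi>2 (Y t)) (Y t)) (at t within {0..}))"
    have mem: "X t \<in> ?M" "Y t \<in> ?M" if "t \<ge> 0" for t using X Y that by auto
    have "X t = Y t" if "t \<ge> 0" for t
    proof (rule lipschitz_ode_unique[OF lipschitz_on_subset[OF C M_R] _ _ _ _ _ that])
      show "(X has_vector_derivative E (X t)) (at t within {0..})" if "t \<ge> 0" for t
        using X that by (simp flip: E[OF mem(1)[OF that]])
      show "(Y has_vector_derivative E (Y t)) (at t within {0..})" if "t \<ge> 0" for t
        using Y that by (simp flip: E[OF mem(2)[OF that]])
    qed (use mem X Y in auto)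
    then show "X = Y"
      by (intro PiE_ext[OF conjunct1[OF X] conjunct1[OF Y]]) simp
  qed
qed

end
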